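(* Let $d\ge 1$ be an integer and let $F$ be the free prosupersoluble group of rank $d$. Then $d_I(F)=2d-1$.
   Context: A finite group is supersoluble if it has a normal series (all terms normal in the whole group) with cyclic factors. A prosupersoluble group is an inverse limit of finite supersoluble groups. The free prosupersoluble group of rank $d$ is the free object on $d$ generators in the category of prosupersoluble groups, i.e. the pro-(finite supersoluble) completion of the abstract free group of rank $d$. For a profinite group $G$, generation is understood topologically. A subset $S\subseteq G$ invariably generates $G$ if, for every choice of elements $g(s)\in G$ ($s\in S$), the set $\{s^{g(s)} \mid s\in S\}$ (where $s^{g}=g^{-1}sg$) topologically generates $G$. $d_I(G)$ denotes the smallest cardinality of a subset that invariably generates $G$. *)

theory Defs
  imports
    "HOL-Algebra.Generated_Groups"
    "HOL-Algebra.Elementary_Groups"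
    "HOL-Algebra.Product_Groups"
    "HOL-Analysis.Function_Topology"
    "HOL-Library.Extended_Nat"
begin

definition finite_supersoluble :: "('a, 'b) monoid_scheme \<Rightarrow> bool" where
  "finite_supersoluble G \<longleftrightarrow>
     group G \<and> finite (carrier G) \<and>
     (\<exists>(n::nat) N. N 0 = {\<one>\<^bsub>G\<^esub>} \<and> N n = carrier G \<and>
        (\<forall>i\<le>n. N i \<lhd> G) \<and>
        (\<forall>i<n. N i \<subseteq> N (Suc i) \<and>
           cyclic_group ((G\<lparr>carrier := N (Suc i)\<rparr>) Mod (N i))))"

text \<open>A topological group is given by a group \<open>G\<close> together with a topology \<open>T\<close>
  whose underlying set is the carrier of \<open>G\<close>.\<close>

definition top_generates :: "('a, 'b) monoid_scheme \<Rightarrow> 'a topology \<Rightarrow> 'a set \<Rightarrow> bool" where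
  "top_generates G T A \<longleftrightarrow> A \<subseteq> carrier G \<and> T closure_of (generate G A) = carrier G"

definition invariably_generates :: "('a, 'b) monoid_scheme \<Rightarrow> 'a topology \<Rightarrow> 'a set \<Rightarrow> bool" where
  "invariably_generates G T S \<longleftrightarrow>
     S \<subseteq> carrier G \<and>
     (\<forall>g. g \<in> S \<rightarrow> carrier G \<longrightarrow>
        top_generates G T ((\<lambda>s. inv\<^bsub>G\<^esub> (g s) \<otimes>\<^bsub>G\<^esub> s \<otimes>\<^bsub>G\<^esub> g s) ` S))"

text \<open>The value is \<open>\<infinity>\<close> exactly when no finite subset invariably generates: infinite
  cardinalities are not distinguished from one another.\<close>

definition d_I :: "('a, 'b) monoid_scheme \<Rightarrow> 'a topology \<Rightarrow> enat" where
  "d_I G T = Inf {enat (card S) | S. finite S \<and> invariably_generates G T S}"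

text \<open>The free group consists of the reduced words. A letter \<open>(True, x)\<close> stands for the generator \<open>x\<close>, and \<open>(False, x)\<close> for its inverse.\<close>

definition inv_letter :: "bool \<times> 'a \<Rightarrow> bool \<times> 'a" where
  "inv_letter a = (\<not> fst a, snd a)"

definition reduced :: "(bool \<times> 'a) list \<Rightarrow> bool" where
  "reduced = successively (\<lambda>a b. b \<noteq> inv_letter a)"

fun push :: "bool \<times> 'a \<Rightarrow> (bool \<times> 'a) list \<Rightarrow> (bool \<times> 'a) list" where
  "push a [] = [a]"
| "push a (b # w) = (if b = inv_letter a then w else a # b # w)"

definition free_group :: "'a set \<Rightarrow> (bool \<times> 'a) list monoid" where
  "free_group X = \<lparr>carrier = {w \<in> lists (UNIV \<times> X). reduced w},
                   monoid.mult = (\<lambda>u v. foldr push u v),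
                   one = []\<rparr>"

lemma inv_letter_simps [simp]:
  "inv_letter (inv_letter a) = a" "inv_letter a \<noteq> a" "a \<noteq> inv_letter a"
  "snd (inv_letter a) = snd a"
  by (cases a; auto simp: inv_letter_def)+

lemma reduced_simps [simp]:
  "reduced []" "reduced [a]"
  "reduced (a # b # w) \<longleftrightarrow> b \<noteq> inv_letter a \<and> reduced (b # w)"
  by (auto simp: reduced_def)

lemma reduced_Cons_D: "reduced (a # w) \<Longrightarrow> reduced w"
  by (cases w) auto

lemma reduced_push: "reduced w \<Longrightarrow> reduced (push a w)"
  by (cases w) (auto dest: reduced_Cons_D)

lemma push_inv_letter: "reduced w \<Longrightarrow> push (inv_letter a) (push a w) = w"
proof (cases w)
  case (Cons b v)
  assume "reduced w"
  with Cons show ?thesis by (cases v) auto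
qed auto

lemma push_inv_letter': "reduced w \<Longrightarrow> push a (push (inv_letter a) w) = w"
  using push_inv_letter[of w "inv_letter a"] by simp

lemma reduced_foldr_push: "reduced v \<Longrightarrow> reduced (foldr push u v)"
  by (induction u) (auto intro: reduced_push)

lemma push_reduced: "reduced (a # w) \<Longrightarrow> push a w = a # w"
  by (cases w) auto

lemma foldr_push_Nil: "reduced w \<Longrightarrow> foldr push w [] = w"
proof (induction w)
  case (Cons a w)
  then show ?case using reduced_Cons_D[of a w] push_reduced[of a w] by simp
qed simp

lemma foldr_push_push:
  assumes "reduced w"
  shows "foldr push (push a t) w = push a (foldr push t w)"
  by (cases t) (auto simp: push_inv_letter' reduced_foldr_push assms)

lemma foldr_push_assoc:
  "reduced w \<Longrightarrow> foldr push (foldr push u v) w = foldr push u (foldr push v w)"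
  by (induction u) (auto simp: foldr_push_push)

lemma foldr_push_inverse:
  "reduced w \<Longrightarrow> foldr push (rev (map inv_letter u)) (foldr push u w) = w"
  by (induction u) (auto simp: push_inv_letter reduced_foldr_push)

lemma push_in_lists:
  "a \<in> UNIV \<times> X \<Longrightarrow> w \<in> lists (UNIV \<times> X) \<Longrightarrow> push a w \<in> lists (UNIV \<times> X)"
  by (cases w) auto

lemma foldr_push_in_lists:
  "u \<in> lists (UNIV \<times> X) \<Longrightarrow> v \<in> lists (UNIV \<times> X) \<Longrightarrow> foldr push u v \<in> lists (UNIV \<times> X)"
proof (induction u)
  case (Cons a u)
  then show ?case using push_in_lists[of a X "foldr push u v"] by simp
qed simp

lemma carrier_free_group: "w \<in> carrier (free_group X) \<longleftrightarrow> w \<in> lists (UNIV \<times> X) \<and> reduced w"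
  by (simp add: free_group_def)

lemma group_free_group: "group (free_group X)"
proof (rule groupI)
  fix u assume u: "u \<in> carrier (free_group X)"
  define v where "v = rev (map inv_letter u)"
  have "v \<in> lists (UNIV \<times> X)"
    using u by (force simp: v_def carrier_free_group inv_letter_def)
  then have "foldr push v [] \<in> carrier (free_group X)"
    unfolding carrier_free_group by (intro conjI foldr_push_in_lists reduced_foldr_push) simp_all
  moreover have "foldr push (foldr push v []) u = []"
    using u foldr_push_assoc[of u v "[]"] foldr_push_inverse[of "[]" u] foldr_push_Nil[of u]
    by (simp add: carrier_free_group v_def)
  ultimately show "\<exists>v\<in>carrier (free_group X). v \<otimes>\<^bsub>free_group X\<^esub> u = \<one>\<^bsub>free_group X\<^esub>"
    by (auto simp: free_group_def)
next
  fix u v assume "u \<in> carrier (free_group X)" "v \<in> carrier (free_group X)"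
  then show "u \<otimes>\<^bsub>free_group X\<^esub> v \<in> carrier (free_group X)"
    using foldr_push_in_lists[of u X v] reduced_foldr_push[of v u] by (simp add: free_group_def)
qed (simp_all add: free_group_def foldr_push_assoc)

lemma free_group_generated:
  "generate (free_group X) ((\<lambda>x. [(True, x)]) ` X) = carrier (free_group X)"
proof
  interpret F: group "free_group X" by (rule group_free_group)
  show "generate (free_group X) ((\<lambda>x. [(True, x)]) ` X) \<subseteq> carrier (free_group X)"
    by (rule F.generate_incl) (auto simp: carrier_free_group)
  have letter: "[a] \<in> generate (free_group X) ((\<lambda>x. [(True, x)]) ` X)" if a: "a \<in> UNIV \<times> X" for a
  proof (cases "fst a")
    case True
    with a show ?thesis by (cases a) (auto intro: generate.incl)
  next
    case False
    then have "[(True, snd a)] \<otimes>\<^bsub>free_group X\<^esub> [a] = \<one>\<^bsub>free_group X\<^esub>"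
      by (cases a) (auto simp: free_group_def inv_letter_def)
    then have "inv\<^bsub>free_group X\<^esub> [(True, snd a)] = [a]"
      using a F.inv_equality[of "[a]" "[(True, snd a)]"] F.inv_comm[of "[(True, snd a)]" "[a]"]
      by (auto simp: carrier_free_group)
    moreover have "[(True, snd a)] \<in> (\<lambda>x. [(True, x)]) ` X"
      using a by auto
    ultimately show ?thesis by (metis generate.inv)
  qed
  show "carrier (free_group X) \<subseteq> generate (free_group X) ((\<lambda>x. [(True, x)]) ` X)"
  proof
    fix w assume "w \<in> carrier (free_group X)"
    then show "w \<in> generate (free_group X) ((\<lambda>x. [(True, x)]) ` X)"
    proof (induction w)
      case Nil
      then show ?case using generate.one[of "free_group X"] by (simp add: free_group_def)
    next
      case (Cons a w)
      then have "w \<in> carrier (free_group X)" "a \<in> UNIV \<times> X"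
        by (auto simp: carrier_free_group dest: reduced_Cons_D)
      then have "[a] \<otimes>\<^bsub>free_group X\<^esub> w \<in> generate (free_group X) ((\<lambda>x. [(True, x)]) ` X)"
        using letter Cons.IH by (blast intro: generate.eng)
      moreover have "[a] \<otimes>\<^bsub>free_group X\<^esub> w = a # w"
        using Cons.prems by (simp add: free_group_def push_reduced)
      ultimately show ?case by simp
    qed
  qed
qed

lemma free_group_universal:
  assumes "group H" and f: "f \<in> X \<rightarrow> carrier H"
  shows "\<exists>h \<in> hom (free_group X) H. \<forall>x\<in>X. h [(True, x)] = f x"
proof -
  interpret H: group H by fact
  define l where "l a = (if fst a then f (snd a) else inv\<^bsub>H\<^esub> (f (snd a)))" for a
  define h where "h w = foldr (\<lambda>a z. l a \<otimes>\<^bsub>H\<^esub> z) w \<one>\<^bsub>H\<^esub>" for w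
  have l: "l a \<in> carrier H" if "a \<in> UNIV \<times> X" for a
    using that f by (cases a) (auto simp: l_def)
  have l_inv: "l (inv_letter a) = inv\<^bsub>H\<^esub> (l a)" if "a \<in> UNIV \<times> X" for a
    using that f by (cases a) (auto simp: l_def inv_letter_def Pi_iff)
  have h: "h w \<in> carrier H" if "w \<in> lists (UNIV \<times> X)" for w
    using that by (induction w) (auto simp: h_def l)
  have push: "h (push a w) = l a \<otimes>\<^bsub>H\<^esub> h w" if "a \<in> UNIV \<times> X" "w \<in> lists (UNIV \<times> X)" for a w
  proof (cases w)
    case (Cons b v)
    with that have "h v \<in> carrier H" using h by auto
    with that Cons show ?thesis
      by (auto simp: h_def l_inv l simp flip: H.m_assoc)
  qed (simp add: h_def)
  have mult: "h (foldr push u v) = h u \<otimes>\<^bsub>H\<^esub> h v"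
    if "u \<in> lists (UNIV \<times> X)" "v \<in> lists (UNIV \<times> X)" for u v
    using that(1)
  proof (induction u)
    case Nil
    then show ?case using h[OF that(2)] by (simp add: h_def)
  next
    case (Cons a u)
    then have "h (foldr push (a # u) v) = l a \<otimes>\<^bsub>H\<^esub> (h u \<otimes>\<^bsub>H\<^esub> h v)"
      using push[of a "foldr push u v"] foldr_push_in_lists[of u X v] that(2) by simp
    also have "\<dots> = h (a # u) \<otimes>\<^bsub>H\<^esub> h v"
      using Cons l[of a] h[of u] h[OF that(2)] by (simp add: h_def H.m_assoc)
    finally show ?case .
  qed
  have "h \<in> hom (free_group X) H"
    using h mult by (auto simp: hom_def free_group_def simp del: in_lists_conv_set)
  moreover have "h [(True, x)] = f x" if "x \<in> X" for x
    using that f by (auto simp: h_def l_def Pi_iff)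
  ultimately show ?thesis by blast
qed

definition quotient_kernels ::
    "('a set monoid \<Rightarrow> bool) \<Rightarrow> ('a, 'b) monoid_scheme \<Rightarrow> 'a set set" where
  "quotient_kernels C G = {N. N \<lhd> G \<and> C (G Mod N)}"

text \<open>The inverse limit of the quotients \<open>G/N\<close> that belong to the class \<open>C\<close>. For \<open>N \<subseteq> M\<close>
  the canonical map \<open>G/N \<rightarrow> G/M\<close> sends a coset \<open>K\<close> of \<open>N\<close> to the coset \<open>M K\<close> of \<open>M\<close>.\<close>

definition pro_completion ::
    "('a set monoid \<Rightarrow> bool) \<Rightarrow> ('a, 'b) monoid_scheme \<Rightarrow> ('a set \<Rightarrow> 'a set) monoid" where
  "pro_completion C G =
     (product_group (quotient_kernels C G) (\<lambda>N. G Mod N))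
       \<lparr>carrier := {x \<in> (\<Pi>\<^sub>E N\<in>quotient_kernels C G. carrier (G Mod N)).
                     \<forall>N\<in>quotient_kernels C G. \<forall>M\<in>quotient_kernels C G.
                       N \<subseteq> M \<longrightarrow> M <#>\<^bsub>G\<^esub> x N = x M}\<rparr>"

definition pro_topology ::
    "('a set monoid \<Rightarrow> bool) \<Rightarrow> ('a, 'b) monoid_scheme \<Rightarrow> ('a set \<Rightarrow> 'a set) topology" where
  "pro_topology C G =
     subtopology
       (product_topology (\<lambda>N. discrete_topology (carrier (G Mod N))) (quotient_kernels C G))
       (carrier (pro_completion C G))"

lemma topspace_pro_topology: "topspace (pro_topology C G) = carrier (pro_completion C G)"
  by (auto simp: pro_topology_def pro_completion_def)

lemma (in group) normal_set_mult_rcos: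
  assumes "N \<lhd> G" "M \<lhd> G" "N \<subseteq> M" "a \<in> carrier G"
  shows "M <#> (N #> a) = M #> a"
proof -
  have MN: "M \<subseteq> carrier G" "N \<subseteq> carrier G" "subgroup M G" "subgroup N G"
    using assms by (auto simp: normal_def subgroup.subset)
  have "M <#> (N #> a) = (M <#> N) #> a"
    using MN assms by (simp add: setmult_rcos_assoc)
  also have "M <#> N = M"
    using MN assms(3) by (intro set_mult_subgroup_idem subgroup_incl)
  finally show ?thesis .
qed

lemma group_pro_completion:
  fixes C :: "'a set monoid \<Rightarrow> bool" and G :: "('a, 'b) monoid_scheme"
  assumes "group G"
  shows "group (pro_completion C G)"
proof -
  interpret G: group G by fact
  let ?Q = "quotient_kernels C G"
  let ?P = "product_group ?Q (\<lambda>N. G Mod N)"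
  let ?H = "{x \<in> (\<Pi>\<^sub>E N\<in>?Q. carrier (G Mod N)).
              \<forall>N\<in>?Q. \<forall>M\<in>?Q. N \<subseteq> M \<longrightarrow> M <#>\<^bsub>G\<^esub> x N = x M}"
  have norm: "N \<lhd> G" if "N \<in> ?Q" for N
    using that by (simp add: quotient_kernels_def)
  have quot: "group (G Mod N)" if "N \<in> ?Q" for N
    using norm[OF that] by (rule normal.factorgroup_is_group)
  interpret P: group ?P using quot by (rule product_group)
  have rep: "\<exists>a\<in>carrier G. x N = N #>\<^bsub>G\<^esub> a \<and> x M = M #>\<^bsub>G\<^esub> a"
    if "x \<in> ?H" "N \<in> ?Q" "M \<in> ?Q" "N \<subseteq> M" for x N M
  proof -
    from that have "x N \<in> carrier (G Mod N)" by (auto simp: PiE_iff)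
    then obtain a where a: "a \<in> carrier G" "x N = N #>\<^bsub>G\<^esub> a"
      by (auto simp: carrier_FactGroup)
    from that have "M <#>\<^bsub>G\<^esub> x N = x M" by blast
    with a G.normal_set_mult_rcos[of N M a] norm that show ?thesis by auto
  qed
  have "subgroup ?H ?P"
  proof (rule P.subgroupI)
    show "?H \<subseteq> carrier ?P" by auto
    have "\<one>\<^bsub>?P\<^esub> N = N #>\<^bsub>G\<^esub> \<one>\<^bsub>G\<^esub>" if "N \<in> ?Q" for N
      using norm[OF that] that by (simp add: normal_def subgroup.subset)
    then have "M <#>\<^bsub>G\<^esub> \<one>\<^bsub>?P\<^esub> N = \<one>\<^bsub>?P\<^esub> M" if "N \<in> ?Q" "M \<in> ?Q" "N \<subseteq> M" for N M
      using that G.normal_set_mult_rcos[of N M "\<one>\<^bsub>G\<^esub>"] norm by simp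
    moreover have "\<one>\<^bsub>?P\<^esub> \<in> carrier ?P" by (rule P.one_closed)
    ultimately have "\<one>\<^bsub>?P\<^esub> \<in> ?H"
      unfolding carrier_product_group mem_Collect_eq by blast
    then show "?H \<noteq> {}" by blast
  next
    fix x assume x: "x \<in> ?H"
    then have xP: "x \<in> carrier ?P" by simp
    have "inv\<^bsub>?P\<^esub> x = (\<lambda>N\<in>?Q. inv\<^bsub>G Mod N\<^esub> x N)"
      using x quot by (intro inv_product_group) auto
    moreover have "inv\<^bsub>G Mod N\<^esub> x N = set_inv\<^bsub>G\<^esub> (x N)" if "N \<in> ?Q" for N
      using x that by (intro normal.inv_FactGroup norm) (auto simp: PiE_iff)
    ultimately have inv: "(inv\<^bsub>?P\<^esub> x) N = set_inv\<^bsub>G\<^esub> (x N)" if "N \<in> ?Q" for N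
      using that by simp
    have "M <#>\<^bsub>G\<^esub> (inv\<^bsub>?P\<^esub> x) N = (inv\<^bsub>?P\<^esub> x) M"
      if "N \<in> ?Q" "M \<in> ?Q" "N \<subseteq> M" for N M
      using rep[OF x that] inv that norm G.normal_set_mult_rcos[of N M]
      by (auto simp: normal.rcos_inv)
    with P.inv_closed[OF xP] show "inv\<^bsub>?P\<^esub> x \<in> ?H"
      unfolding carrier_product_group mem_Collect_eq by blast
  next
    fix x y assume xy: "x \<in> ?H" "y \<in> ?H"
    have "M <#>\<^bsub>G\<^esub> (x \<otimes>\<^bsub>?P\<^esub> y) N = (x \<otimes>\<^bsub>?P\<^esub> y) M"
      if "N \<in> ?Q" "M \<in> ?Q" "N \<subseteq> M" for N M
      using rep[OF xy(1) that] rep[OF xy(2) that] that norm G.normal_set_mult_rcos[of N M]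
      by (auto simp: normal.rcos_sum)
    moreover have "x \<otimes>\<^bsub>?P\<^esub> y \<in> carrier ?P"
      using xy by (intro P.m_closed) simp_all
    ultimately show "x \<otimes>\<^bsub>?P\<^esub> y \<in> ?H"
      unfolding carrier_product_group mem_Collect_eq by blast
  qed
  then show ?thesis
    unfolding pro_completion_def by (rule P.subgroup_imp_group)
qed

text \<open>The free object on \<open>d\<close> generators in the category of prosupersoluble groups,
  realised as the pro-(finite supersoluble) completion of the abstract free group of rank \<open>d\<close>.\<close>

definition free_prosupersoluble :: "nat \<Rightarrow>
    ((bool \<times> nat) list set \<Rightarrow> (bool \<times> nat) list set) monoid" where
  "free_prosupersoluble d = pro_completion finite_supersoluble (free_group {..<d})"

definition free_prosupersoluble_topology :: "nat \<Rightarrow>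
    ((bool \<times> nat) list set \<Rightarrow> (bool \<times> nat) list set) topology" where
  "free_prosupersoluble_topology d = pro_topology finite_supersoluble (free_group {..<d})"

end

theory Submission
  imports Defs "HOL-Algebra.Zassenhaus" "HOL-Library.Numeral_Type"
begin

text \<open>Let \<open>M\<close> be a maximal subgroup of a finite supersoluble group, and divide by the core of \<open>M\<close>. The
  result is a semidirect product of a cyclic normal subgroup \<open>B\<close> with \<open>M\<close>, where \<open>B\<close> is its own centralizer.
  Whether a set generates invariably is decided in these quotients: the set fails if all
  of its elements have conjugates in one and the same \<open>M\<close>, and an element of \<open>B\<close> has such a conjugate only if it is trivial.

  For the upper bound, add to the free generators \<open>x\<^sub>1, \<dots>, x\<^sub>d\<close> elements \<open>y\<^sub>2, \<dots>, y\<^sub>d\<close>. Suppose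
  everything is conjugate into \<open>M\<close>, and let \<open>x\<^sub>k\<close> be the first generator outside \<open>B\<close>. The earlier ones lie in
  \<open>B\<close> and are trivial; for the same reason not all generators can lie in \<open>B\<close>. If \<open>y\<^sub>j\<close> equals the commutator of \<open>x\<^sub>j\<close> with \<open>x\<^sub>k\<close> for all \<open>j > k\<close>, then it lies in \<open>B\<close>, so it
  is trivial and \<open>x\<^sub>k\<close> is central, which contradicts that \<open>x\<^sub>k\<close> does not centralize \<open>B\<close>. The difficulty is
  that \<open>y\<^sub>j\<close> must not depend on \<open>k\<close>, nor on \<open>M\<close>. Iterating \<open>c \<mapsto> [c, a]\<close> exactly \<open>n!\<close> times gives for large \<open>n\<close>
  the identity of \<open>B\<close> if \<open>a\<close> is outside \<open>B\<close>, and the trivial map if \<open>a\<close> is trivial. With this switch one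
  word selects the commutator with the first \<open>x\<^sub>k\<close> that is outside \<open>B\<close> (\<open>witness\<close>). In each
  finite quotient the word stops changing as \<open>n\<close> grows, so the words converge in the free prosupersoluble
  group (\<open>generators_and_pro_witnesses_invariably_generate\<close>).

  For the lower bound, the prime \<open>3\<close> suffices. Suppose a set \<open>S\<close> has at most \<open>2 d - 2\<close> elements. Either a nontrivial
  homomorphism to \<open>{1, -1}\<close> is trivial on \<open>S\<close>, or some homomorphism \<open>\<chi>\<close> to \<open>{1, -1}\<close> has the value \<open>-1\<close> at \<open>d\<close>
  elements of \<open>S\<close> and hence the value \<open>1\<close> at no more than \<open>d - 2\<close> of them. The lifts of \<open>\<chi>\<close> to the group of affine
  maps \<open>z \<mapsto> \<plusminus>z + b\<close> modulo \<open>3\<close> have \<open>d - 1\<close> degrees of freedom up to conjugation by translations, so one of them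
  is surjective and trivial on the elements of \<open>S\<close> with sign \<open>1\<close>. All other elements of \<open>S\<close> are
  reflections, so that each element of \<open>S\<close> has a conjugate in the stabilizer of \<open>0\<close>
  (\<open>invariable_generation_lower_bound\<close>).\<close>

section \<open>Iterated commutators\<close>

text \<open>On a finite set with at most \<open>n\<close> elements every orbit of a self-map becomes periodic after at
  most \<open>n\<close> steps, with a period that is at most \<open>n\<close> and hence divides \<open>n!\<close>. So the \<open>n!\<close>-th iterate
  is idempotent, and it no longer changes when \<open>n\<close> grows.\<close>

lemma funpow_fact_dvd:
  assumes "finite A" "f \<in> A \<rightarrow> A" "x \<in> A" "card A \<le> n" "fact n dvd m" "m > (0::nat)"
  shows "(f ^^ m) x = (f ^^ fact n) x"
proof -
  have in_A: "(f ^^ i) x \<in> A" for i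
    using assms(2,3) by (induction i) auto
  have "\<not> inj_on (\<lambda>i. (f ^^ i) x) {..card A}"
  proof
    assume "inj_on (\<lambda>i. (f ^^ i) x) {..card A}"
    then have "card {..card A} \<le> card A"
      using in_A assms(1) by (intro card_inj_on_le) auto
    then show False by simp
  qed
  then obtain i j where ij: "i < j" "j \<le> card A" "(f ^^ i) x = (f ^^ j) x"
    by (auto simp: inj_on_def) (metis linorder_neqE_nat)
  have shift: "(f ^^ (t + (j - i))) x = (f ^^ t) x" if "i \<le> t" for t
  proof -
    have "(f ^^ (t + (j - i))) x = (f ^^ (t - i)) ((f ^^ j) x)"
      using that ij(1) by (simp flip: funpow_add add: fun_cong[OF funpow_add, symmetric, unfolded comp_def])
    also have "\<dots> = (f ^^ t) x"
      using that by (simp flip: ij(3) add: fun_cong[OF funpow_add, symmetric, unfolded comp_def])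
    finally show ?thesis .
  qed
  have shifts: "(f ^^ (t + k * (j - i))) x = (f ^^ t) x" if "i \<le> t" for t k
  proof (induction k)
    case (Suc k)
    then show ?case using shift[of "t + k * (j - i)"] that by (simp add: ac_simps)
  qed simp
  have "(j - i) dvd fact n"
    using ij assms(4) by (intro dvd_fact) auto
  then obtain k where k: "m = fact n + k * (j - i)"
  proof -
    assume *: "\<And>k. m = fact n + k * (j - i) \<Longrightarrow> thesis" and d: "j - i dvd fact n"
    obtain q where q: "m = fact n * q" using assms(5) by blast
    then have "q \<noteq> 0" using assms(6) by auto
    then have "m = fact n + fact n * (q - 1)" using q by (cases q) auto
    moreover obtain r where "fact n = (j - i) * r" using d by blast
    ultimately show thesis using *[of "r * (q - 1)"] by (metis mult.assoc mult.commute)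
  qed
  have "i \<le> fact n"
    using ij assms(4) fact_ge_self[of n] by linarith
  then show ?thesis
    unfolding k by (rule shifts)
qed

definition commutator :: "('a, 'b) monoid_scheme \<Rightarrow> 'a \<Rightarrow> 'a \<Rightarrow> 'a" where
  "commutator G x y = x \<otimes>\<^bsub>G\<^esub> y \<otimes>\<^bsub>G\<^esub> inv\<^bsub>G\<^esub> x \<otimes>\<^bsub>G\<^esub> inv\<^bsub>G\<^esub> y"

text \<open>The exponent \<open>n!\<close> makes \<open>c \<mapsto> [c, a, \<dots>, a]\<close> an idempotent map on a group of order at most \<open>n\<close>.
  On an abelian normal subgroup \<open>B\<close> of such a group, it is the trivial map if \<open>a\<close> centralizes \<open>B\<close> and
  the identity if \<open>a\<close> acts on \<open>B\<close> without nontrivial fixed points: one word decides between the two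
  cases for all primes at once.\<close>

definition engel :: "('a, 'b) monoid_scheme \<Rightarrow> nat \<Rightarrow> 'a \<Rightarrow> 'a \<Rightarrow> 'a" where
  "engel G n a = (\<lambda>c. commutator G c a) ^^ fact n"

text \<open>The second factor turns the value \<open>c\<close> of the remaining word into \<open>c (engel a c)\<inverse>\<close>. This is \<open>c\<close> if \<open>a\<close>
  is trivial, and it is trivial where \<open>a\<close> acts without nontrivial fixed points. So the first such letter \<open>a\<close>,
  if preceded by trivial letters only, takes control of the word, and the value is the commutator of \<open>z\<close>
  with \<open>a\<close>.\<close>

fun witness :: "('a, 'b) monoid_scheme \<Rightarrow> nat \<Rightarrow> 'a list \<Rightarrow> 'a \<Rightarrow> 'a" where
  "witness G n [] z = \<one>\<^bsub>G\<^esub>"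
| "witness G n (a # as) z = commutator G z a \<otimes>\<^bsub>G\<^esub>
     (witness G n as z \<otimes>\<^bsub>G\<^esub> inv\<^bsub>G\<^esub> (engel G n a (witness G n as z)))"

context group
begin

lemma commutator_closed [simp]:
  "x \<in> carrier G \<Longrightarrow> y \<in> carrier G \<Longrightarrow> commutator G x y \<in> carrier G"
  by (simp add: commutator_def)

lemma inv_cancel:
  assumes "x \<in> carrier G" "y \<in> carrier G"
  shows "inv x \<otimes> (x \<otimes> y) = y" "x \<otimes> (inv x \<otimes> y) = y"
  using assms by (simp_all flip: m_assoc)

lemma commutator_eq_one_iff:
  assumes "x \<in> carrier G" "y \<in> carrier G"
  shows "commutator G x y = \<one> \<longleftrightarrow> x \<otimes> y = y \<otimes> x"
proof -
  have "commutator G x y = (x \<otimes> y) \<otimes> inv (y \<otimes> x)"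
    using assms by (simp add: commutator_def inv_mult_group m_assoc)
  then show ?thesis
    using assms inv_solve_right'[of \<one> "x \<otimes> y" "y \<otimes> x"] by auto
qed

lemma engel_closed [simp]:
  assumes "a \<in> carrier G" "c \<in> carrier G"
  shows "engel G n a c \<in> carrier G"
proof -
  have "((\<lambda>c. commutator G c a) ^^ k) c \<in> carrier G" for k
    using assms by (induction k) auto
  then show ?thesis by (simp add: engel_def)
qed

lemma witness_closed [simp]:
  "set as \<subseteq> carrier G \<Longrightarrow> z \<in> carrier G \<Longrightarrow> witness G n as z \<in> carrier G"
  by (induction as) auto

lemma engel_stable:
  assumes "finite (carrier G)" "order G \<le> n" "a \<in> carrier G" "c \<in> carrier G"
  shows "engel G n a c = engel G (order G) a c"
  unfolding engel_def using assms
  by (intro funpow_fact_dvd[where A = "carrier G"]) (auto simp: order_def intro: fact_dvd)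

text \<open>By stability, the values of these words in the finite quotients of a group are compatible
  even though each quotient uses its own order as the parameter \<open>n\<close>.\<close>

lemma witness_stable:
  assumes "finite (carrier G)" "order G \<le> n" "set as \<subseteq> carrier G" "z \<in> carrier G"
  shows "witness G n as z = witness G (order G) as z"
  using assms(3)
proof (induction as)
  case (Cons a as)
  then show ?case
    using assms(4) engel_stable[OF assms(1,2), of a "witness G (order G) as z"] by simp
qed simp

end

context group_hom
begin

lemma hom_commutator:
  "x \<in> carrier G \<Longrightarrow> y \<in> carrier G \<Longrightarrow> h (commutator G x y) = commutator H (h x) (h y)"
  by (simp add: commutator_def)

lemma hom_engel:
  assumes "a \<in> carrier G" "c \<in> carrier G"
  shows "h (engel G n a c) = engel H n (h a) (h c)"
proof -
  have "((\<lambda>c. commutator G c a) ^^ k) c \<in> carrier G \<and>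
        h (((\<lambda>c. commutator G c a) ^^ k) c) = ((\<lambda>c. commutator H c (h a)) ^^ k) (h c)" for k
    using assms by (induction k) (auto simp: hom_commutator)
  then show ?thesis by (simp add: engel_def)
qed

lemma hom_witness:
  assumes "set as \<subseteq> carrier G" "z \<in> carrier G"
  shows "h (witness G n as z) = witness H n (map h as) (h z)"
  using assms(1) by (induction as) (use assms(2) in \<open>auto simp: hom_commutator hom_engel\<close>)

end

section \<open>Primitive groups with a cyclic normal subgroup\<close>

text \<open>A maximal subgroup of a finite supersoluble group gives rise to this situation after division
  by its core. Here \<open>B\<close> is a cyclic complement of \<open>M\<close> that coincides with its centralizer, and \<open>G / B\<close>
  acts on \<open>B\<close> by powers.\<close>

locale primitive_cyclic = group G for G (structure) +
  fixes M B :: "'a set" and t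
  assumes M: "subgroup M G"
    and M_maximal: "\<And>H. subgroup H G \<Longrightarrow> M \<subseteq> H \<Longrightarrow> H \<noteq> M \<Longrightarrow> H = carrier G"
    and M_proper: "M \<noteq> carrier G"
    and core_free: "\<And>N. N \<lhd> G \<Longrightarrow> N \<subseteq> M \<Longrightarrow> N = {\<one>}"
    and B: "B \<lhd> G"
    and B_nontrivial: "B \<noteq> {\<one>}"
    and t: "t \<in> carrier G"
    and B_powers: "B = range (\<lambda>k::int. t [^] k)"
begin

lemma B_carrier: "b \<in> B \<Longrightarrow> b \<in> carrier G"
  using B_powers t by auto

lemma M_carrier: "b \<in> M \<Longrightarrow> b \<in> carrier G"
  using subgroup.mem_carrier[OF M] .

lemma t_in_B: "t \<in> B"
proof -
  have "t [^] (1::int) \<in> B" unfolding B_powers by (rule rangeI)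
  then show ?thesis using t by simp
qed

lemma subgroup_B: "subgroup B G"
  using B by (rule normal_imp_subgroup)

lemma B_commute: "b \<in> B \<Longrightarrow> c \<in> B \<Longrightarrow> b \<otimes> c = c \<otimes> b"
  using t by (auto simp: B_powers add.commute simp flip: int_pow_mult)

lemma hom_conj: "g \<in> carrier G \<Longrightarrow> (\<lambda>x. g \<otimes> x \<otimes> inv g) \<in> hom G G"
  by (rule homI) (simp_all add: m_assoc inv_cancel)

lemma conj_int_pow:
  assumes "g \<in> carrier G" "x \<in> carrier G"
  shows "g \<otimes> x [^] (k::int) \<otimes> inv g = (g \<otimes> x \<otimes> inv g) [^] k"
proof -
  interpret c: group_hom G G "\<lambda>x. g \<otimes> x \<otimes> inv g"
    using hom_conj[OF assms(1)] by unfold_locales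
  show ?thesis using c.hom_int_pow[OF assms(2)] .
qed

lemma acts_by_powers:
  assumes "g \<in> carrier G"
  obtains r :: int where "\<And>b. b \<in> B \<Longrightarrow> g \<otimes> b \<otimes> inv g = b [^] r"
proof -
  have "g \<otimes> t \<otimes> inv g \<in> B"
    using normal.inv_op_closed2[OF B assms t_in_B] .
  then obtain r :: int where r: "g \<otimes> t \<otimes> inv g = t [^] r"
    unfolding B_powers by blast
  have "g \<otimes> b \<otimes> inv g = b [^] r" if b: "b \<in> B" for b
  proof -
    obtain k :: int where "b = t [^] k" using b unfolding B_powers by blast
    then show ?thesis
      using conj_int_pow[OF assms t, of k] r t by (simp add: int_pow_pow mult.commute)
  qed
  then show thesis by (rule that)
qed

text \<open>Conjugation acts on the cyclic group \<open>B\<close> by powers, and subgroups are closed under powers.\<close>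

lemma subgroup_of_B_normal:
  assumes "subgroup U G" "U \<subseteq> B"
  shows "U \<lhd> G"
  unfolding normal_inv_iff
proof (intro conjI ballI)
  fix g u assume "g \<in> carrier G" "u \<in> U"
  then obtain r :: int where "g \<otimes> u \<otimes> inv g = u [^] r"
    using acts_by_powers assms(2) by (metis subsetD)
  then show "g \<otimes> u \<otimes> inv g \<in> U"
    using subgroup_int_pow_closed[OF assms(1) \<open>u \<in> U\<close>] by simp
qed (fact assms(1))

lemma M_Int_B: "M \<inter> B = {\<one>}"
  using M subgroup_B by (intro core_free subgroup_of_B_normal subgroups_Inter_pair) auto

text \<open>This is the obstruction behind invariable generation: an element of \<open>B\<close> can be moved into the
  maximal subgroup \<open>M\<close> only if it is trivial.\<close>

lemma conjugate_into_M_trivial: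
  assumes "s \<in> B" "g \<in> carrier G" "inv g \<otimes> s \<otimes> g \<in> M"
  shows "s = \<one>"
proof -
  have "inv g \<otimes> s \<otimes> g \<in> M \<inter> B"
    using normal.inv_op_closed1[OF B assms(2,1)] assms(3) by blast
  then have "inv g \<otimes> s \<otimes> g = \<one>" using M_Int_B by blast
  then have "s \<otimes> g = g"
    using assms B_carrier by (metis inv_closed inv_inv inv_solve_left m_assoc m_closed r_one)
  then show ?thesis using assms B_carrier by (metis r_cancel_one')
qed

lemma complement:
  assumes "subgroup U G" "U \<subseteq> B" "U \<noteq> {\<one>}"
  shows "M <#> U = carrier G"
proof (rule M_maximal)
  have U: "U \<lhd> G" by (rule subgroup_of_B_normal[OF assms(1,2)])
  show "subgroup (M <#> U) G"
    using mult_norm_subgroup[OF U M] commut_normal[OF M U] by simp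
  have one: "\<one> \<in> U" "\<one> \<in> M" using assms(1) M by (auto intro: subgroup.one_closed)
  show "M \<subseteq> M <#> U"
  proof
    fix m assume "m \<in> M"
    then have "m = m \<otimes> \<one>" using M_carrier by simp
    then show "m \<in> M <#> U" using \<open>m \<in> M\<close> one unfolding set_mult_def by blast
  qed
  have "U \<subseteq> M <#> U"
  proof
    fix u assume "u \<in> U"
    then have "u = \<one> \<otimes> u" using B_carrier assms(2) by auto
    then show "u \<in> M <#> U" using \<open>u \<in> U\<close> one unfolding set_mult_def by blast
  qed
  moreover have "\<not> U \<subseteq> M" using core_free[OF U] assms(3) by blast
  ultimately show "M <#> U \<noteq> M" by blast
qed

text \<open>Write \<open>C\<close> for the centralizer of \<open>U\<close>. The group \<open>C \<inter> M\<close> is normalized by \<open>M\<close> and centralized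
  by \<open>U\<close>, hence normal because \<open>G = M U\<close>, hence trivial because \<open>M\<close> is core-free. As \<open>U\<close> is
  abelian, the \<open>M\<close>-part of an element of \<open>C\<close> lies in \<open>C \<inter> M\<close>, so \<open>C = U\<close>.\<close>

lemma centralizer:
  assumes U: "subgroup U G" "U \<subseteq> B" "U \<noteq> {\<one>}"
    and x: "x \<in> carrier G" "\<And>u. u \<in> U \<Longrightarrow> x \<otimes> u = u \<otimes> x"
  shows "x \<in> U"
proof -
  define C where "C = {c \<in> carrier G. \<forall>u\<in>U. c \<otimes> u \<otimes> inv c = u}"
  have Uc: "u \<in> carrier G" if "u \<in> U" for u using U(1) that by (rule subgroup.mem_carrier)
  have C_iff: "c \<in> C \<longleftrightarrow> (\<forall>u\<in>U. c \<otimes> u = u \<otimes> c)" if "c \<in> carrier G" for c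
    using that Uc by (auto simp: C_def inv_solve_right')
  have nU: "U \<lhd> G" by (rule subgroup_of_B_normal[OF U(1,2)])
  have conjU: "g \<otimes> u \<otimes> inv g \<in> U" "inv g \<otimes> u \<otimes> g \<in> U" if "g \<in> carrier G" "u \<in> U" for g u
    using nU that by (auto intro: normal.inv_op_closed2 normal.inv_op_closed1)
  have comp: "(g \<otimes> h) \<otimes> u \<otimes> inv (g \<otimes> h) = g \<otimes> (h \<otimes> u \<otimes> inv h) \<otimes> inv g"
    if "g \<in> carrier G" "h \<in> carrier G" "u \<in> carrier G" for g h u
    using that by (simp add: inv_mult_group m_assoc)
  have sC: "subgroup C G"
  proof (rule subgroupI)
    show "C \<subseteq> carrier G" by (auto simp: C_def)
    show "C \<noteq> {}" using Uc by (auto simp: C_def intro!: exI[of _ \<one>])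
  next
    fix a assume a: "a \<in> C"
    then have ac: "a \<in> carrier G" by (simp add: C_def)
    have "inv a \<otimes> u \<otimes> inv (inv a) = u" if "u \<in> U" for u
    proof -
      have "a \<otimes> u \<otimes> inv a = u" using a that by (simp add: C_def)
      then have "inv a \<otimes> u \<otimes> a = inv a \<otimes> (a \<otimes> u \<otimes> inv a) \<otimes> a" by simp
      also have "\<dots> = u" using ac Uc[OF that] by (simp add: m_assoc inv_cancel)
      finally show ?thesis using ac by simp
    qed
    then show "inv a \<in> C" using ac by (simp add: C_def)
  next
    fix a b assume "a \<in> C" "b \<in> C"
    then show "a \<otimes> b \<in> C" using Uc by (simp add: C_def comp)
  qed
  have C_conj: "g \<otimes> c \<otimes> inv g \<in> C" if g: "g \<in> carrier G" and c: "c \<in> C" for g c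
  proof -
    have cc: "c \<in> carrier G" using c by (simp add: C_def)
    have "(g \<otimes> c \<otimes> inv g) \<otimes> u \<otimes> inv (g \<otimes> c \<otimes> inv g) = u" if u: "u \<in> U" for u
    proof -
      have "(g \<otimes> c \<otimes> inv g) \<otimes> u \<otimes> inv (g \<otimes> c \<otimes> inv g) =
            g \<otimes> (c \<otimes> (inv g \<otimes> u \<otimes> inv (inv g)) \<otimes> inv c) \<otimes> inv g"
        using g cc Uc[OF u] comp[of "g \<otimes> c" "inv g" u]
          comp[of g c "inv g \<otimes> u \<otimes> inv (inv g)"] by simp
      also have "c \<otimes> (inv g \<otimes> u \<otimes> inv (inv g)) \<otimes> inv c = inv g \<otimes> u \<otimes> inv (inv g)"
        using c conjU(2)[OF g u] g by (simp add: C_def)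
      also have "g \<otimes> (inv g \<otimes> u \<otimes> inv (inv g)) \<otimes> inv g = u"
        using g Uc[OF u] by (simp add: m_assoc inv_cancel)
      finally show ?thesis .
    qed
    then show ?thesis using g cc by (simp add: C_def)
  qed
  have decomp: "\<exists>m\<in>M. \<exists>u\<in>U. g = m \<otimes> u" if "g \<in> carrier G" for g
    using that complement[OF U] unfolding set_mult_def by blast
  have "C \<inter> M \<lhd> G"
    unfolding normal_inv_iff
  proof (intro conjI ballI)
    show "subgroup (C \<inter> M) G" by (rule subgroups_Inter_pair[OF sC M])
    fix g c assume g: "g \<in> carrier G" and c: "c \<in> C \<inter> M"
    obtain m u where mu: "m \<in> M" "u \<in> U" "g = m \<otimes> u" using decomp[OF g] by blast
    have cc: "c \<in> carrier G" using c by (simp add: C_def)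
    have "c \<otimes> u = u \<otimes> c" using c cc C_iff mu by blast
    then have "u \<otimes> c \<otimes> inv u = c" using cc Uc[OF mu(2)] by (simp add: inv_solve_right')
    then have "g \<otimes> c \<otimes> inv g = m \<otimes> c \<otimes> inv m"
      using mu Uc[OF mu(2)] cc M_carrier by (simp add: comp)
    also have "\<dots> \<in> M" using mu(1) c M by (simp add: subgroup.m_closed subgroup.m_inv_closed)
    finally show "g \<otimes> c \<otimes> inv g \<in> C \<inter> M" using C_conj[OF g, of c] c by blast
  qed
  then have CM: "C \<inter> M = {\<one>}" by (intro core_free) auto
  obtain m u where mu: "m \<in> M" "u \<in> U" "x = m \<otimes> u" using decomp[OF x(1)] by blast
  have "x \<in> C" using x C_iff by blast
  moreover have "u \<in> C" using C_iff[OF Uc[OF mu(2)]] B_commute mu(2) U(2) by blast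
  ultimately have "x \<otimes> inv u \<in> C" using sC by (simp add: subgroup.m_closed subgroup.m_inv_closed)
  moreover have "x \<otimes> inv u = m" using mu Uc M_carrier by (simp add: m_assoc)
  ultimately have "m = \<one>" using CM mu(1) by blast
  then show ?thesis using mu Uc by simp
qed

text \<open>The fixed points of \<open>x\<close> in \<open>B\<close> form a subgroup \<open>U\<close>. If \<open>U\<close> were nontrivial, it would contain
  its own centralizer and therefore \<open>x\<close>.\<close>

lemma no_fixed_points:
  assumes "x \<in> carrier G" "x \<notin> B" "b \<in> B" "b \<otimes> x = x \<otimes> b"
  shows "b = \<one>"
proof -
  define U where "U = {b \<in> B. b \<otimes> x \<otimes> inv b = x}"
  have U_iff: "b \<in> U \<longleftrightarrow> b \<in> B \<and> b \<otimes> x = x \<otimes> b" for b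
    using assms(1) B_carrier by (auto simp: U_def inv_solve_right')
  have "subgroup U G"
  proof (rule subgroupI)
    show "U \<subseteq> carrier G" using B_carrier by (auto simp: U_def)
    show "U \<noteq> {}" using assms(3,4) U_iff by blast
  next
    fix a assume a: "a \<in> U"
    then have ac: "a \<in> carrier G" using B_carrier U_iff by blast
    have "x = inv a \<otimes> (x \<otimes> a)"
      using a ac assms(1) U_iff by (simp add: inv_solve_left)
    then have "x \<otimes> inv a = inv a \<otimes> x"
      using ac assms(1) inv_solve_right'[of "inv a \<otimes> x" x a]
      by (simp add: inv_solve_right' m_assoc)
    then show "inv a \<in> U"
      using a U_iff subgroup_B by (simp add: subgroup.m_inv_closed)
  next
    fix a b assume "a \<in> U" "b \<in> U"
    then have "a \<in> carrier G" "b \<in> carrier G" "a \<otimes> x = x \<otimes> a" "b \<otimes> x = x \<otimes> b"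
      using U_iff B_carrier by auto
    then have "a \<otimes> b \<otimes> x = x \<otimes> (a \<otimes> b)"
      using assms(1) by (metis m_assoc)
    then show "a \<otimes> b \<in> U"
      using \<open>a \<in> U\<close> \<open>b \<in> U\<close> U_iff subgroup_B by (simp add: subgroup.m_closed)
  qed
  moreover have "U \<subseteq> B" by (auto simp: U_def)
  ultimately have "U = {\<one>}"
    using centralizer[of U x] assms(1,2) U_iff by (metis subsetD)
  then show ?thesis using assms(3,4) U_iff by blast
qed

text \<open>Any two power maps commute, so commutators act trivially on \<open>B\<close> and lie in its centralizer.\<close>

lemma commutator_in_B:
  assumes xy: "x \<in> carrier G" "y \<in> carrier G"
  shows "commutator G x y \<in> B"
proof (rule centralizer[OF subgroup_B subset_refl B_nontrivial])
  obtain r :: int where r: "\<And>b. b \<in> B \<Longrightarrow> x \<otimes> b \<otimes> inv x = b [^] r"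
    using acts_by_powers[OF xy(1)] by blast
  obtain s :: int where s: "\<And>b. b \<in> B \<Longrightarrow> y \<otimes> b \<otimes> inv y = b [^] s"
    using acts_by_powers[OF xy(2)] by blast
  have pow: "b [^] (k::int) \<in> B" if "b \<in> B" for b k
    using subgroup_int_pow_closed[OF subgroup_B that] .
  have swap: "x \<otimes> y \<otimes> b \<otimes> inv (x \<otimes> y) = y \<otimes> x \<otimes> b \<otimes> inv (y \<otimes> x)" if b: "b \<in> B" for b
  proof -
    have "x \<otimes> y \<otimes> b \<otimes> inv (x \<otimes> y) = x \<otimes> (y \<otimes> b \<otimes> inv y) \<otimes> inv x"
      using xy B_carrier[OF b] by (simp add: m_assoc inv_mult_group)
    also have "\<dots> = (b [^] s) [^] r" using r s pow b by simp
    also have "\<dots> = (b [^] r) [^] s"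
      using B_carrier[OF b] by (simp add: int_pow_pow mult.commute)
    also have "\<dots> = y \<otimes> (x \<otimes> b \<otimes> inv x) \<otimes> inv y" using r s pow b by simp
    also have "\<dots> = y \<otimes> x \<otimes> b \<otimes> inv (y \<otimes> x)"
      using xy B_carrier[OF b] by (simp add: m_assoc inv_mult_group)
    finally show ?thesis .
  qed
  fix b assume b: "b \<in> B"
  define w where "w = inv (y \<otimes> x) \<otimes> b \<otimes> (y \<otimes> x)"
  have w: "w \<in> B"
    unfolding w_def using xy b by (intro normal.inv_op_closed1[OF B]) auto
  have "b = y \<otimes> x \<otimes> w \<otimes> inv (y \<otimes> x)"
  proof -
    have "y \<otimes> x \<otimes> w = b \<otimes> (y \<otimes> x)"
      unfolding w_def using xy B_carrier[OF b] by (simp add: m_assoc[symmetric])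
    then show ?thesis using xy B_carrier[OF b] by (simp add: m_assoc)
  qed
  also have "\<dots> = x \<otimes> y \<otimes> w \<otimes> inv (x \<otimes> y)" by (rule swap[OF w, symmetric])
  finally have "b \<otimes> (x \<otimes> y) = (x \<otimes> y) \<otimes> w"
    using xy B_carrier[OF b] B_carrier[OF w] by (simp add: inv_solve_right)
  moreover have c: "commutator G x y = (x \<otimes> y) \<otimes> inv (y \<otimes> x)"
    using xy by (simp add: commutator_def m_assoc inv_mult_group)
  moreover have "w \<otimes> inv (y \<otimes> x) = inv (y \<otimes> x) \<otimes> b"
    unfolding w_def using xy B_carrier[OF b] by (simp add: m_assoc)
  ultimately show "commutator G x y \<otimes> b = b \<otimes> commutator G x y"
    using xy B_carrier[OF b] B_carrier[OF w]
    by (metis inv_closed m_assoc m_closed)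
qed (use xy in simp)

lemma engel_in_B:
  assumes "a \<in> carrier G" "c \<in> B"
  shows "engel G n a c \<in> B"
proof -
  have "((\<lambda>c. commutator G c a) ^^ k) c \<in> B" for k
    using assms by (induction k) (auto intro: commutator_in_B B_carrier)
  then show ?thesis by (simp add: engel_def)
qed

lemma witness_in_B:
  assumes "set as \<subseteq> carrier G" "z \<in> carrier G"
  shows "witness G n as z \<in> B"
  using assms(1)
proof (induction as)
  case Nil
  then show ?case using subgroup.one_closed[OF subgroup_B] by simp
next
  case (Cons a as)
  then have "witness G n as z \<in> B" "a \<in> carrier G" by auto
  then show ?case
    using subgroup_B assms(2)
    by (auto intro!: subgroup.m_closed subgroup.m_inv_closed commutator_in_B engel_in_B)
qed

lemma engel_one:
  assumes "c \<in> carrier G"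
  shows "engel G n \<one> c = \<one>"
proof -
  have one: "commutator G c \<one> = \<one>" if "c \<in> carrier G" for c
    using that by (simp add: commutator_def)
  have "((\<lambda>c. commutator G c \<one>) ^^ Suc k) c = \<one>" for k
    using assms by (induction k) (auto simp: one)
  moreover obtain k where "fact n = Suc k"
    using fact_ge_Suc_0_nat[of n] by (metis Suc_le_D)
  ultimately show ?thesis by (simp only: engel_def)
qed

lemma witness_one_Cons:
  assumes "set as \<subseteq> carrier G" "z \<in> carrier G"
  shows "witness G n (\<one> # as) z = witness G n as z"
  using assms by (simp add: engel_one commutator_def)

text \<open>Without fixed points in \<open>B\<close>, the map \<open>c \<mapsto> [c, a]\<close> is injective on \<open>B\<close>, and an injective
  idempotent map is the identity.\<close>

lemma engel_outside:
  assumes B_finite: "finite B" "card B \<le> n" and a: "a \<in> carrier G" "a \<notin> B" and c: "c \<in> B"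
  shows "engel G n a c = c"
proof -
  let ?f = "\<lambda>c. commutator G c a"
  have maps: "?f \<in> B \<rightarrow> B"
    using a(1) by (auto intro: commutator_in_B B_carrier)
  have "inj_on ?f B"
  proof (rule inj_onI)
    fix b c assume bc: "b \<in> B" "c \<in> B" "?f b = ?f c"
    have car: "b \<in> carrier G" "c \<in> carrier G" using bc B_carrier by auto
    have "b \<otimes> a \<otimes> inv b = c \<otimes> a \<otimes> inv c"
      using bc(3) car a(1) unfolding commutator_def by simp
    then have "inv c \<otimes> (b \<otimes> a \<otimes> inv b) \<otimes> b = inv c \<otimes> (c \<otimes> a \<otimes> inv c) \<otimes> b" by simp
    then have "(inv c \<otimes> b) \<otimes> a = a \<otimes> (inv c \<otimes> b)"
      using car a(1) by (simp add: m_assoc inv_cancel)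
    then have "inv c \<otimes> b = \<one>"
      using bc subgroup_B
      by (intro no_fixed_points[OF a]) (auto intro: subgroup.m_closed subgroup.m_inv_closed)
    then show "b = c"
      using car by (metis inv_cancel(2) r_one)
  qed
  then have inj: "inj_on (?f ^^ k) B" for k
  proof (induction k)
    case (Suc k)
    have "(?f ^^ k) ` B \<subseteq> B" using maps by (induction k) auto
    then show ?case
      using comp_inj_on[OF Suc.IH[OF Suc.prems] inj_on_subset[OF Suc.prems]] by (simp add: comp_def)
  qed simp
  \<comment> \<open>The iterate is idempotent because \<open>n!\<close> divides \<open>2 \<cdot> n!\<close>.\<close>
  have "(?f ^^ fact n) ((?f ^^ fact n) c) = (?f ^^ (2 * fact n)) c"
    by (simp add: mult_2 funpow_add)
  also have "\<dots> = (?f ^^ fact n) c"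
    using B_finite maps c by (intro funpow_fact_dvd) auto
  finally have "(?f ^^ fact n) ((?f ^^ fact n) c) = (?f ^^ fact n) c" .
  moreover have "(?f ^^ fact n) c \<in> B"
    using engel_in_B[OF a(1) c] by (simp add: engel_def)
  ultimately show ?thesis
    using inj_onD[OF inj] c by (auto simp: engel_def)
qed

lemma witness_outside:
  assumes "finite B" "card B \<le> n" "a \<in> carrier G" "a \<notin> B" "set as \<subseteq> carrier G" "z \<in> carrier G"
  shows "witness G n (a # as) z = commutator G z a"
  using assms by (simp add: engel_outside witness_in_B)

text \<open>Suppose that all these elements have conjugates in \<open>M\<close>. Those that lie in \<open>B\<close> are then trivial.
  So the generators that precede the first one outside \<open>B\<close>, say \<open>a\<close>, are trivial, and for each later
  generator \<open>y\<close> the witness reduces to the commutator of \<open>y\<close> with \<open>a\<close>, which lies in \<open>B\<close> and is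
  therefore trivial as well. Hence \<open>a\<close> is central, although it has no nontrivial fixed point in \<open>B\<close>.\<close>

lemma generators_or_witnesses_avoid_conjugates:
  assumes xs: "set xs \<subseteq> carrier G" "generate G (set xs) = carrier G"
    and B_finite: "finite B" "card B \<le> n"
    and gens: "\<And>x. x \<in> set xs \<Longrightarrow> \<exists>g\<in>carrier G. inv g \<otimes> x \<otimes> g \<in> M"
    and wits: "\<And>us x vs. xs = us @ x # vs \<Longrightarrow>
                 \<exists>g\<in>carrier G. inv g \<otimes> witness G n us x \<otimes> g \<in> M"
  shows False
proof (cases "set xs \<subseteq> B")
  case True
  then have "set xs \<subseteq> {\<one>}"
    using gens conjugate_into_M_trivial by blast
  then have "generate G (set xs) \<subseteq> {\<one>}"
    using generate_subgroup_incl triv_subgroup by blast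
  then show False
    using xs(2) M_proper M subgroup.one_closed subgroup.subset by fastforce
next
  case False
  then obtain us a vs where split: "xs = us @ a # vs" "a \<notin> B" "set us \<subseteq> B"
    using split_list_first_prop[of xs "\<lambda>x. x \<notin> B"] by blast
  have us: "us = replicate (length us) \<one>"
    using split gens conjugate_into_M_trivial by (intro replicate_length_same[symmetric]) auto
  have a: "a \<in> carrier G" using xs(1) split(1) by auto
  have skip: "witness G n (replicate k \<one> @ ws) y = witness G n ws y"
    if "set ws \<subseteq> carrier G" "y \<in> carrier G" for k ws y
  proof (induction k)
    case (Suc k)
    have "set (replicate k \<one> @ ws) \<subseteq> carrier G" using that(1) by auto
    from witness_one_Cons[OF this that(2), of n] Suc show ?case by (simp del: witness.simps)
  qed simp
  have comm: "a \<otimes> y = y \<otimes> a" if y: "y \<in> set xs" for y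
  proof -
    consider "y \<in> set us" | "y = a" | "y \<in> set vs" using y split(1) by auto
    then show ?thesis
    proof cases
      case 1
      then have "y = \<one>" using us by (metis in_set_replicate)
      then show ?thesis using a by simp
    next
      case 3
      then obtain v1 v2 where v: "vs = v1 @ y # v2" by (meson split_list)
      have car: "y \<in> carrier G" "set v1 \<subseteq> carrier G" using xs(1) split(1) v by auto
      have "witness G n (us @ a # v1) y = commutator G y a"
        using skip[of "a # v1" y "length us"] witness_outside[OF B_finite a split(2)] car a us
        by simp
      moreover obtain g where "g \<in> carrier G" "inv g \<otimes> witness G n (us @ a # v1) y \<otimes> g \<in> M"
        using wits[of "us @ a # v1" y v2] split(1) v by auto
      ultimately have "commutator G y a = \<one>"
        using conjugate_into_M_trivial commutator_in_B[OF car(1) a] by metis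
      then show ?thesis using commutator_eq_one_iff[OF car(1) a] by simp
    qed simp
  qed
  have central: "a \<otimes> y = y \<otimes> a" if "y \<in> generate G (set xs)" for y
    using that
  proof (induction rule: generate.induct)
    case (inv h)
    then have h: "h \<in> carrier G" using xs by auto
    have "inv h \<otimes> (a \<otimes> h) \<otimes> inv h = inv h \<otimes> (h \<otimes> a) \<otimes> inv h" using comm[OF inv] by simp
    then show ?case using a h by (simp add: m_assoc inv_cancel)
  next
    case (eng h1 h2)
    then have "h1 \<in> carrier G" "h2 \<in> carrier G" using xs(2) by auto
    then show ?case using a eng by (metis m_assoc)
  qed (use a comm in auto)
  obtain b where "b \<in> B" "b \<noteq> \<one>"
    using B_nontrivial subgroup.one_closed[OF subgroup_B] by blast
  then show False
    using no_fixed_points[OF a split(2)] central xs(2) B_carrier by auto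
qed

end

section \<open>Supersoluble quotients\<close>

text \<open>This says that \<open>A / N\<close> is cyclic, in terms of elements of \<open>G\<close>: pulling back along homomorphisms
  and intersecting with subgroups then need no passage to quotient groups.\<close>

definition cyclic_over :: "('a, 'b) monoid_scheme \<Rightarrow> 'a set \<Rightarrow> 'a set \<Rightarrow> bool" where
  "cyclic_over G N A \<longleftrightarrow> (\<exists>b\<in>A. \<forall>c\<in>A. \<exists>k::int. c \<otimes>\<^bsub>G\<^esub> inv\<^bsub>G\<^esub> (b [^]\<^bsub>G\<^esub> k) \<in> N)"

lemma (in normal) r_coset_eq_iff:
  assumes "x \<in> carrier G" "y \<in> carrier G"
  shows "H #> x = H #> y \<longleftrightarrow> x \<otimes> inv y \<in> H"
proof -
  have "x \<otimes> inv y \<in> H \<longleftrightarrow> x \<in> H #> y"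
    using rcos_module[OF is_group assms(2,1)] by simp
  also have "\<dots> \<longleftrightarrow> H #> x = H #> y"
    using repr_independence[OF _ assms(2) subgroup_axioms, of x] rcos_self[OF assms(1) subgroup_axioms]
    by blast
  finally show ?thesis by blast
qed

lemma (in group) cyclic_factor_iff:
  assumes N: "N \<lhd> G" and A: "subgroup A G" and sub: "N \<subseteq> A"
  shows "cyclic_group ((G\<lparr>carrier := A\<rparr>) Mod N) \<longleftrightarrow> cyclic_over G N A"
proof -
  interpret A: group "G\<lparr>carrier := A\<rparr>" using A by (rule subgroup_imp_group)
  interpret NA: normal N "G\<lparr>carrier := A\<rparr>"
    by (rule normal_restrict_supergroup[OF A N sub])
  interpret N: normal N G by (rule N)
  interpret Q: group "(G\<lparr>carrier := A\<rparr>) Mod N" by (rule NA.factorgroup_is_group)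
  have car: "carrier ((G\<lparr>carrier := A\<rparr>) Mod N) = (\<lambda>x. N #> x) ` A"
    by (simp add: carrier_FactGroup)
  have pow: "(N #> b) [^]\<^bsub>(G\<lparr>carrier := A\<rparr>) Mod N\<^esub> k = N #> (b [^] k)" if "b \<in> A" for b and k :: int
    using NA.FactGroup_int_pow[of b k] that int_pow_consistent[OF A that] by simp
  have mem: "x \<in> carrier G" if "x \<in> A" for x using subgroup.mem_carrier[OF A that] .
  have eq: "N #> c = N #> (b [^] k) \<longleftrightarrow> c \<otimes> inv (b [^] k) \<in> N"
    if "b \<in> A" "c \<in> A" for b c and k :: int
    using that mem by (intro N.r_coset_eq_iff) auto
  have "cyclic_group ((G\<lparr>carrier := A\<rparr>) Mod N) \<longleftrightarrow>
        (\<exists>b\<in>A. (\<lambda>x. N #> x) ` A = range (\<lambda>k::int. N #> (b [^] k)))"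
    unfolding Q.cyclic_group car using pow by simp
  also have "\<dots> \<longleftrightarrow> (\<exists>b\<in>A. \<forall>c\<in>A. \<exists>k::int. N #> c = N #> (b [^] k))"
  proof (intro bex_cong refl)
    fix b assume b: "b \<in> A"
    have "b [^] k \<in> A" for k :: int by (rule subgroup_int_pow_closed[OF A b])
    then show "(\<lambda>x. N #> x) ` A = range (\<lambda>k::int. N #> (b [^] k)) \<longleftrightarrow>
               (\<forall>c\<in>A. \<exists>k::int. N #> c = N #> (b [^] k))"
    proof (intro iffI ballI)
      fix c assume "(\<lambda>x. N #> x) ` A = range (\<lambda>k::int. N #> (b [^] k))" "c \<in> A"
      then have "N #> c \<in> range (\<lambda>k::int. N #> (b [^] k))" by blast
      then show "\<exists>k::int. N #> c = N #> (b [^] k)" by blast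
    qed auto
  qed
  also have "\<dots> \<longleftrightarrow> cyclic_over G N A"
    unfolding cyclic_over_def using eq by (intro bex_cong ball_cong ex_cong1 refl) auto
  finally show ?thesis .
qed

lemma int_subgroup_principal:
  fixes I :: "int set"
  assumes "0 \<in> I" "\<And>a b. a \<in> I \<Longrightarrow> b \<in> I \<Longrightarrow> a - b \<in> I"
  obtains d where "d \<in> I" "\<And>k. k \<in> I \<Longrightarrow> d dvd k"
proof (cases "I \<subseteq> {0}")
  case True
  then show thesis using that[of 0] assms(1) by auto
next
  case False
  have neg: "- a \<in> I" if "a \<in> I" for a using assms(2)[OF assms(1) that] by simp
  have add: "a + b \<in> I" if "a \<in> I" "b \<in> I" for a b
    using assms(2)[OF that(1) neg[OF that(2)]] by simp
  have mult: "d * k \<in> I" if "d \<in> I" for d k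
  proof (induction k rule: int_induct[where k = 0])
    case (step1 i)
    then show ?case using add[OF _ that] by (simp add: distrib_left)
  next
    case (step2 i)
    then show ?case using assms(2)[OF _ that] by (simp add: right_diff_distrib)
  qed (use assms(1) in simp)
  obtain a where "a \<in> I" "a \<noteq> 0" using False by auto
  then have "\<bar>a\<bar> \<in> I" using neg[of a] by (cases "a \<ge> 0") simp_all
  then have "int (nat \<bar>a\<bar>) \<in> I \<and> 0 < nat \<bar>a\<bar>" using \<open>a \<noteq> 0\<close> by simp
  then obtain d where d: "int d \<in> I" "0 < d" and least: "\<And>e. e < d \<Longrightarrow> \<not> (int e \<in> I \<and> 0 < e)"
    using exists_least_iff[of "\<lambda>d. int d \<in> I \<and> 0 < d"] by blast
  have "int d dvd k" if "k \<in> I" for k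
  proof -
    have "k mod int d = k - int d * (k div int d)" by (simp add: minus_mult_div_eq_mod)
    then have "k mod int d \<in> I" using assms(2)[OF that mult[OF d(1)]] by simp
    then have "int (nat (k mod int d)) \<in> I" using d(2) by simp
    moreover have "nat (k mod int d) < d" using d(2) by (simp add: nat_less_iff)
    ultimately have "nat (k mod int d) = 0"
      using least[of "nat (k mod int d)"] by auto
    moreover have "k mod int d \<ge> 0" using d(2) by simp
    ultimately have "k mod int d = 0" by linarith
    then show ?thesis by (rule mod_0_imp_dvd)
  qed
  then show thesis using that d(1) by blast
qed

text \<open>A subgroup of a cyclic group is cyclic: the exponents \<open>k\<close> for which the coset of \<open>b\<^sup>k\<close> is attained by
  \<open>h\<close> on the relevant part of \<open>L\<close> form a subgroup of the integers, and a generator of that subgroup yields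
  a generator of the preimage.\<close>

lemma (in group_hom) cyclic_over_vimage:
  assumes L: "subgroup L G" and N: "N \<lhd> H" and A: "subgroup A H" and cyc: "cyclic_over H N A"
  shows "cyclic_over G {x \<in> L. h x \<in> N} {x \<in> L. h x \<in> A}"
proof -
  interpret N: normal N H by (rule N)
  obtain b where b: "b \<in> A" and pow: "\<And>c. c \<in> A \<Longrightarrow> \<exists>k::int. c \<otimes>\<^bsub>H\<^esub> inv\<^bsub>H\<^esub> (b [^]\<^bsub>H\<^esub> k) \<in> N"
    using cyc unfolding cyclic_over_def by blast
  have bH: "b \<in> carrier H" using subgroup.mem_carrier[OF A b] .
  have LG: "x \<in> carrier G" if "x \<in> L" for x using subgroup.mem_carrier[OF L that] .
  have eq: "N #>\<^bsub>H\<^esub> h x = N #>\<^bsub>H\<^esub> (b [^]\<^bsub>H\<^esub> k) \<longleftrightarrow> h x \<otimes>\<^bsub>H\<^esub> inv\<^bsub>H\<^esub> (b [^]\<^bsub>H\<^esub> k) \<in> N"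
    if "x \<in> L" for x and k :: int
    using LG[OF that] bH by (intro N.r_coset_eq_iff) auto
  define I where "I = {k::int. \<exists>x\<in>L. h x \<in> A \<and> N #>\<^bsub>H\<^esub> h x = N #>\<^bsub>H\<^esub> (b [^]\<^bsub>H\<^esub> k)}"
  interpret Q: group "H Mod N" by (rule N.factorgroup_is_group)
  interpret p: group_hom H "H Mod N" "\<lambda>x. N #>\<^bsub>H\<^esub> x"
    using N.r_coset_hom_Mod by unfold_locales
  have "0 \<in> I"
    using subgroup.one_closed[OF L] subgroup.one_closed[OF A]
    by (auto simp: I_def intro!: bexI[of _ "\<one>"])
  moreover have "i - j \<in> I" if ij: "i \<in> I" "j \<in> I" for i j
  proof -
    obtain x y where x: "x \<in> L" "h x \<in> A" "N #>\<^bsub>H\<^esub> h x = N #>\<^bsub>H\<^esub> (b [^]\<^bsub>H\<^esub> i)"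
      and y: "y \<in> L" "h y \<in> A" "N #>\<^bsub>H\<^esub> h y = N #>\<^bsub>H\<^esub> (b [^]\<^bsub>H\<^esub> j)"
      using ij unfolding I_def by blast
    have "N #>\<^bsub>H\<^esub> h (x \<otimes> inv y) = (N #>\<^bsub>H\<^esub> h x) \<otimes>\<^bsub>H Mod N\<^esub> inv\<^bsub>H Mod N\<^esub> (N #>\<^bsub>H\<^esub> h y)"
      using LG x y by (simp del: mult_FactGroup)
    also have "\<dots> = N #>\<^bsub>H\<^esub> (b [^]\<^bsub>H\<^esub> (i - j))"
      using x(3) y(3) bH by (simp add: int_pow_diff del: mult_FactGroup)
    finally have "N #>\<^bsub>H\<^esub> h (x \<otimes> inv y) = N #>\<^bsub>H\<^esub> (b [^]\<^bsub>H\<^esub> (i - j))" .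
    moreover have "x \<otimes> inv y \<in> L"
      using x(1) y(1) L by (simp add: subgroup.m_closed subgroup.m_inv_closed)
    moreover have "h (x \<otimes> inv y) \<in> A"
      using x y A LG by (simp add: subgroup.m_closed subgroup.m_inv_closed)
    ultimately show ?thesis unfolding I_def by blast
  qed
  ultimately obtain d where d: "d \<in> I" "\<And>k. k \<in> I \<Longrightarrow> d dvd k"
    using int_subgroup_principal by blast
  then obtain y where y: "y \<in> L" "h y \<in> A" "N #>\<^bsub>H\<^esub> h y = N #>\<^bsub>H\<^esub> (b [^]\<^bsub>H\<^esub> d)"
    unfolding I_def by blast
  have "\<exists>q::int. x \<otimes> inv (y [^] q) \<in> {x \<in> L. h x \<in> N}" if x: "x \<in> {x \<in> L. h x \<in> A}" for x
  proof -
    obtain k :: int where k: "h x \<otimes>\<^bsub>H\<^esub> inv\<^bsub>H\<^esub> (b [^]\<^bsub>H\<^esub> k) \<in> N" using pow x by blast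
    then have Nk: "N #>\<^bsub>H\<^esub> h x = N #>\<^bsub>H\<^esub> (b [^]\<^bsub>H\<^esub> k)" using eq x by blast
    then have "k \<in> I" using x unfolding I_def by blast
    then obtain q where q: "k = d * q" using d(2) by blast
    have "N #>\<^bsub>H\<^esub> h (y [^] q) = (N #>\<^bsub>H\<^esub> h y) [^]\<^bsub>H Mod N\<^esub> q"
      using LG[OF y(1)] by (simp add: hom_int_pow p.hom_int_pow)
    also have "\<dots> = N #>\<^bsub>H\<^esub> (b [^]\<^bsub>H\<^esub> k)"
      using bH by (simp add: y(3) q p.hom_int_pow[symmetric] int_pow_pow)
    finally have "N #>\<^bsub>H\<^esub> h x = N #>\<^bsub>H\<^esub> h (y [^] q)" using Nk by simp
    then have "h (x \<otimes> inv (y [^] q)) \<in> N"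
      using N.r_coset_eq_iff[of "h x" "h (y [^] q)"] x LG y(1) by simp
    moreover have "x \<otimes> inv (y [^] q) \<in> L"
      using x y(1) L G.subgroup_int_pow_closed[OF L y(1)]
      by (simp add: subgroup.m_closed subgroup.m_inv_closed)
    ultimately show ?thesis by blast
  qed
  then show ?thesis using y unfolding cyclic_over_def by blast
qed

text \<open>For normal \<open>N\<close>, this expresses within \<open>G\<close> that \<open>G / N\<close> has a normal series with cyclic factors.
  The induction descends from the top of the series.\<close>

inductive supersoluble_above :: "('a, 'b) monoid_scheme \<Rightarrow> 'a set \<Rightarrow> bool" for G where
  top: "supersoluble_above G (carrier G)"
| step: "supersoluble_above G N"
    if "N \<lhd> G" "A \<lhd> G" "N \<subseteq> A" "cyclic_over G N A" "supersoluble_above G A"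

lemma (in group) supersoluble_above_series:
  assumes "supersoluble_above G A"
  shows "\<exists>(n::nat) N. N 0 = A \<and> N n = carrier G \<and> (\<forall>i\<le>n. N i \<lhd> G) \<and>
           (\<forall>i<n. N i \<subseteq> N (Suc i) \<and> cyclic_group ((G\<lparr>carrier := N (Suc i)\<rparr>) Mod (N i)))"
  using assms
proof induction
  case top
  show ?case by (intro exI[of _ 0] exI[of _ "\<lambda>_. carrier G"]) (simp add: normal_self)
next
  case (step M A)
  then obtain n :: nat and N where N: "N 0 = A" "N n = carrier G" "\<forall>i\<le>n. N i \<lhd> G"
    "\<forall>i<n. N i \<subseteq> N (Suc i) \<and> cyclic_group ((G\<lparr>carrier := N (Suc i)\<rparr>) Mod (N i))" by blast
  have "cyclic_group ((G\<lparr>carrier := A\<rparr>) Mod M)"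
    using step cyclic_factor_iff by (simp add: normal_imp_subgroup)
  then show ?case
    using N step
    by (intro exI[of _ "Suc n"] exI[of _ "case_nat M N"]) (auto split: nat.splits simp: less_Suc_eq_0_disj)
qed

lemma (in group) supersoluble_above_of_series:
  assumes "N n = carrier G" "\<And>i. i \<le> n \<Longrightarrow> N i \<lhd> G"
    "\<And>i. i < n \<Longrightarrow> N i \<subseteq> N (Suc i) \<and> cyclic_group ((G\<lparr>carrier := N (Suc i)\<rparr>) Mod (N i))"
  shows "supersoluble_above G (N (0::nat))"
proof (rule inc_induct[of 0 n])
  show "supersoluble_above G (N n)" unfolding assms(1) by (rule top)
next
  fix i assume i: "i < n" "supersoluble_above G (N (Suc i))"
  have "cyclic_over G (N i) (N (Suc i))"
    using cyclic_factor_iff[of "N i" "N (Suc i)"] assms(2)[of i] assms(2)[of "Suc i"] assms(3)[OF i(1)] i(1)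
    by (simp add: normal_imp_subgroup)
  then show "supersoluble_above G (N i)"
    using i assms(2)[of i] assms(2)[of "Suc i"] assms(3)[OF i(1)] by (intro step[of "N i" G "N (Suc i)"]) auto
qed simp

lemma finite_supersoluble_iff:
  "finite_supersoluble G \<longleftrightarrow>
     group G \<and> finite (carrier G) \<and> supersoluble_above G {\<one>\<^bsub>G\<^esub>}"
proof
  assume "finite_supersoluble G"
  then obtain n :: nat and N where N: "group G" "finite (carrier G)" "N 0 = {\<one>\<^bsub>G\<^esub>}" "N n = carrier G"
    "\<forall>i\<le>n. N i \<lhd> G"
    "\<forall>i<n. N i \<subseteq> N (Suc i) \<and> cyclic_group ((G\<lparr>carrier := N (Suc i)\<rparr>) Mod (N i))"
    unfolding finite_supersoluble_def by blast
  have "supersoluble_above G (N 0)"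
    by (rule group.supersoluble_above_of_series[where N = N and n = n]) (use N in blast)+
  then show "group G \<and> finite (carrier G) \<and> supersoluble_above G {\<one>\<^bsub>G\<^esub>}" using N(1-3) by simp
next
  assume "group G \<and> finite (carrier G) \<and> supersoluble_above G {\<one>\<^bsub>G\<^esub>}"
  then show "finite_supersoluble G"
    unfolding finite_supersoluble_def by (intro conjI group.supersoluble_above_series) simp_all
qed

lemma (in group_hom) subgroup_vimage:
  assumes "subgroup K H"
  shows "subgroup {x \<in> carrier G. h x \<in> K} G"
  using subgroup.one_closed[OF assms] subgroup.m_closed[OF assms] subgroup.m_inv_closed[OF assms]
  by (intro G.subgroupI) (auto intro!: exI[of _ \<one>])

lemma (in group_hom) normal_vimage:
  assumes "N \<lhd> H"
  shows "{x \<in> carrier G. h x \<in> N} \<lhd> G"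
proof -
  interpret N: normal N H by (rule assms)
  have "subgroup {x \<in> carrier G. h x \<in> N} G"
    by (rule subgroup_vimage[OF N.subgroup_axioms])
  then show ?thesis
    unfolding G.normal_inv_iff using N.inv_op_closed2 by auto
qed

lemma (in group_hom) supersoluble_above_vimage:
  assumes "supersoluble_above H A"
  shows "supersoluble_above G {x \<in> carrier G. h x \<in> A}"
  using assms
proof induction
  case top
  have "{x \<in> carrier G. h x \<in> carrier H} = carrier G" by auto
  then show ?case using supersoluble_above.top by simp
next
  case (step N A)
  show ?case
    using step cyclic_over_vimage[OF G.subgroup_self step(1) normal_imp_subgroup[OF step(2)] step(4)]
    by (intro supersoluble_above.step[OF normal_vimage[OF step(1)] normal_vimage[OF step(2)]]) auto
qed

text \<open>Below a series from \<open>A\<close> to \<open>G\<close>, the intersections of \<open>A\<close> with a series from \<open>B\<close> to \<open>G\<close> continue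
  it down to \<open>A \<inter> B\<close>.\<close>

lemma (in group) supersoluble_above_Int:
  assumes "supersoluble_above G A" "A \<lhd> G" "supersoluble_above G B"
  shows "supersoluble_above G (A \<inter> B)"
  using assms(3)
proof induction
  case top
  have "A \<inter> carrier G = A" using normal_imp_subgroup[OF assms(2)] subgroup.subset by blast
  then show ?case using assms(1) by simp
next
  case (step N B)
  interpret i: group_hom G G "\<lambda>x. x" by unfold_locales (auto simp: hom_def)
  have "cyclic_over G {x \<in> A. x \<in> N} {x \<in> A. x \<in> B}"
    using step by (intro i.cyclic_over_vimage) (auto intro: normal_imp_subgroup assms(2))
  then have "cyclic_over G (A \<inter> N) (A \<inter> B)" by (simp add: Int_def)
  then show ?case
    using step assms(2)
    by (intro supersoluble_above.step[of "A \<inter> N" G "A \<inter> B"] normal_subgroup_intersect) auto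
qed

lemma (in group_hom) supersoluble_above_image:
  assumes "supersoluble_above G A" "h ` carrier G = carrier H"
  shows "supersoluble_above H (h ` A)"
  using assms(1)
proof induction
  case top
  show ?case unfolding assms(2) by (rule supersoluble_above.top)
next
  case (step N A)
  obtain b where b: "b \<in> A" and pow: "\<And>c. c \<in> A \<Longrightarrow> \<exists>k::int. c \<otimes> inv (b [^] k) \<in> N"
    using step(4) unfolding cyclic_over_def by blast
  have AG: "x \<in> carrier G" if "x \<in> A" for x
    using subgroup.mem_carrier[OF normal_imp_subgroup[OF step(2)] that] .
  have "\<exists>k::int. h c \<otimes>\<^bsub>H\<^esub> inv\<^bsub>H\<^esub> (h b [^]\<^bsub>H\<^esub> k) \<in> h ` N" if c: "c \<in> A" for c
  proof -
    obtain k :: int where "c \<otimes> inv (b [^] k) \<in> N" using pow[OF c] by blast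
    then have "h (c \<otimes> inv (b [^] k)) \<in> h ` N" by (rule imageI)
    then show ?thesis using AG[OF c] AG[OF b] by (auto simp: hom_int_pow)
  qed
  then have "cyclic_over H (h ` N) (h ` A)" using b unfolding cyclic_over_def by blast
  moreover have "h ` N \<lhd> H" "h ` A \<lhd> H"
    using normal.surj_hom_normal_subgroup[OF step(1) group_hom_axioms assms(2)]
      normal.surj_hom_normal_subgroup[OF step(2) group_hom_axioms assms(2)] by auto
  ultimately show ?case
    using step by (intro supersoluble_above.step[of "h ` N" H "h ` A"]) auto
qed

lemma (in group) quotient_kernels_iff:
  "N \<in> quotient_kernels finite_supersoluble G \<longleftrightarrow>
     N \<lhd> G \<and> finite (carrier (G Mod N)) \<and> supersoluble_above G N"
proof (cases "N \<lhd> G")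
  case True
  interpret N: normal N G by (rule True)
  interpret Q: group "G Mod N" by (rule N.factorgroup_is_group)
  interpret p: group_hom G "G Mod N" "\<lambda>x. N #> x"
    using N.r_coset_hom_Mod by unfold_locales
  have surj: "(\<lambda>x. N #> x) ` carrier G = carrier (G Mod N)" by (simp add: carrier_FactGroup)
  have "{x \<in> carrier G. N #> x \<in> {N}} = N"
    using N.r_coset_eq_iff[of _ \<one>] N.subset by auto
  then have "supersoluble_above (G Mod N) {N} \<Longrightarrow> supersoluble_above G N"
    using p.supersoluble_above_vimage[of "{N}"] by simp
  moreover have "(\<lambda>x. N #> x) ` N = {N}"
    using N.rcos_const[OF is_group] N.one_closed by (auto simp: image_def intro!: exI[of _ \<one>])
  then have "supersoluble_above G N \<Longrightarrow> supersoluble_above (G Mod N) {N}"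
    using p.supersoluble_above_image[OF _ surj, of N] by simp
  ultimately show ?thesis
    using True Q.is_group by (auto simp: quotient_kernels_def finite_supersoluble_iff)
qed (simp add: quotient_kernels_def)

lemma (in group) quotient_kernels_Int:
  assumes "M \<in> quotient_kernels finite_supersoluble G" "N \<in> quotient_kernels finite_supersoluble G"
  shows "M \<inter> N \<in> quotient_kernels finite_supersoluble G"
proof -
  have MN: "M \<lhd> G" "N \<lhd> G" and fin: "finite (carrier (G Mod M))" "finite (carrier (G Mod N))"
    and ss: "supersoluble_above G M" "supersoluble_above G N"
    using assms by (auto simp: quotient_kernels_iff)
  have "carrier (G Mod (M \<inter> N)) \<subseteq> (\<lambda>(X, Y). X \<inter> Y) ` (carrier (G Mod M) \<times> carrier (G Mod N))"
  proof
    fix X assume "X \<in> carrier (G Mod (M \<inter> N))"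
    then obtain x where x: "x \<in> carrier G" "X = (M \<inter> N) #> x" by (auto simp: carrier_FactGroup)
    have "X = (M #> x) \<inter> (N #> x)"
    proof
      show "X \<subseteq> (M #> x) \<inter> (N #> x)" unfolding x r_coset_def by blast
      show "(M #> x) \<inter> (N #> x) \<subseteq> X"
      proof
        fix y assume "y \<in> (M #> x) \<inter> (N #> x)"
        then obtain m n where mn: "m \<in> M" "n \<in> N" "y = m \<otimes> x" "y = n \<otimes> x"
          unfolding r_coset_def by blast
        moreover have "m \<in> carrier G" "n \<in> carrier G"
          using mn(1,2) MN[THEN normal_imp_subgroup, THEN subgroup.subset] by auto
        ultimately have "m = n" using x(1) by simp
        then show "y \<in> X" using mn unfolding x r_coset_def by blast
      qed
    qed
    then show "X \<in> (\<lambda>(X, Y). X \<inter> Y) ` (carrier (G Mod M) \<times> carrier (G Mod N))"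
      using x(1) by (auto simp: carrier_FactGroup)
  qed
  then have "finite (carrier (G Mod (M \<inter> N)))"
    using fin by (meson finite_SigmaI finite_imageI finite_subset)
  then show ?thesis
    using MN ss by (simp add: quotient_kernels_iff normal_subgroup_intersect supersoluble_above_Int)
qed

lemma (in group) carrier_in_quotient_kernels:
  "carrier G \<in> quotient_kernels finite_supersoluble G"
proof -
  have "carrier (G Mod carrier G) \<subseteq> {carrier G}"
    using coset_join2[OF _ subgroup_self] by (auto simp: carrier_FactGroup)
  then have "finite (carrier (G Mod carrier G))" using finite_subset by blast
  then show ?thesis by (simp add: quotient_kernels_iff normal_self supersoluble_above.top)
qed

text \<open>The index set of the inverse limit is directed.\<close>

lemma (in group) quotient_kernels_Inter:
  assumes "finite F" "F \<subseteq> quotient_kernels finite_supersoluble G"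
  obtains N where "N \<in> quotient_kernels finite_supersoluble G" "\<And>M. M \<in> F \<Longrightarrow> N \<subseteq> M"
proof -
  have "\<exists>N\<in>quotient_kernels finite_supersoluble G. \<forall>M\<in>F. N \<subseteq> M"
    using assms
  proof (induction F)
    case empty
    then show ?case using carrier_in_quotient_kernels by blast
  next
    case (insert M F)
    then obtain N where "N \<in> quotient_kernels finite_supersoluble G" "\<forall>M\<in>F. N \<subseteq> M" by auto
    then show ?case
      using insert.prems quotient_kernels_Int[of M N] by (intro bexI[of _ "M \<inter> N"]) auto
  qed
  then show thesis using that by blast
qed

lemma (in group_hom) kernel_in_quotient_kernels:
  assumes "finite_supersoluble H"
  shows "kernel G H h \<in> quotient_kernels finite_supersoluble G"
proof -
  have H: "finite (carrier H)" "supersoluble_above H {\<one>\<^bsub>H\<^esub>}"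
    using assms by (auto simp: finite_supersoluble_iff)
  have "finite (carrier (G Mod kernel G H h))"
  proof (rule inj_on_finite[OF FactGroup_inj_on _ H(1)])
    show "(\<lambda>X. the_elem (h ` X)) ` carrier (G Mod kernel G H h) \<subseteq> carrier H"
      using FactGroup_the_elem_mem by blast
  qed
  moreover have "supersoluble_above G (kernel G H h)"
    using supersoluble_above_vimage[OF H(2)] by (simp add: kernel_def)
  ultimately show ?thesis
    using normal_kernel by (simp add: G.quotient_kernels_iff)
qed

text \<open>Take the step at which the series leaves \<open>K\<close>. With \<open>K\<close> the core of a maximal subgroup, this
  produces a nontrivial cyclic normal subgroup modulo \<open>K\<close>.\<close>

lemma supersoluble_above_leaves:
  assumes "supersoluble_above G N" "N \<subseteq> K" "\<not> carrier G \<subseteq> K"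
  shows "\<exists>N' A. N' \<lhd> G \<and> A \<lhd> G \<and> N' \<subseteq> K \<and> \<not> A \<subseteq> K \<and> cyclic_over G N' A"
  using assms
proof induction
  case (step N A)
  then show ?case by (cases "A \<subseteq> K") blast+
qed simp

section \<open>Invariable generation of finite supersoluble groups\<close>

text \<open>It suffices to treat a maximal subgroup \<open>M\<close>. Dividing by its core \<open>K\<close>, the largest normal subgroup
  inside \<open>M\<close>, leads to a primitive group, in which the first term of a supersoluble series that is not
  contained in \<open>K\<close> has a nontrivial cyclic normal image.\<close>

lemma (in group) generators_and_witnesses_not_in_proper_subgroup:
  assumes ss: "finite_supersoluble G"
    and xs: "set xs \<subseteq> carrier G" "generate G (set xs) = carrier G"
    and n: "order G \<le> n"
    and L: "subgroup L G"
    and gens: "\<And>x. x \<in> set xs \<Longrightarrow> \<exists>g\<in>carrier G. inv g \<otimes> x \<otimes> g \<in> L"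
    and wits: "\<And>us x vs. xs = us @ x # vs \<Longrightarrow>
                 \<exists>g\<in>carrier G. inv g \<otimes> witness G n us x \<otimes> g \<in> L"
  shows "L = carrier G"
proof (rule ccontr)
  assume L_proper: "L \<noteq> carrier G"
  have fin: "finite (carrier G)" and above: "supersoluble_above G {\<one>}"
    using ss by (auto simp: finite_supersoluble_iff)
  have "finite {H. subgroup H G \<and> H \<noteq> carrier G}"
    by (rule finite_subset[of _ "Pow (carrier G)"]) (use fin in \<open>auto dest: subgroup.subset\<close>)
  moreover have "L \<in> {H. subgroup H G \<and> H \<noteq> carrier G}" using L L_proper by simp
  ultimately have "\<exists>M\<in>{H. subgroup H G \<and> H \<noteq> carrier G}. L \<subseteq> M \<and>
      (\<forall>H\<in>{H. subgroup H G \<and> H \<noteq> carrier G}. M \<subseteq> H \<longrightarrow> M = H)"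
    by (rule finite_has_maximal2)
  then obtain M where M: "subgroup M G" "M \<noteq> carrier G" "L \<subseteq> M"
    and maximal: "\<And>H. subgroup H G \<Longrightarrow> H \<noteq> carrier G \<Longrightarrow> M \<subseteq> H \<Longrightarrow> M = H"
    by auto
  have MG: "M \<subseteq> carrier G" using M(1) by (rule subgroup.subset)
  define K where "K = {x \<in> carrier G. \<forall>g\<in>carrier G. g \<otimes> x \<otimes> inv g \<in> M}"
  have K_M: "K \<subseteq> M"
  proof
    fix x assume "x \<in> K"
    then have "x \<in> carrier G" "\<one> \<otimes> x \<otimes> inv \<one> \<in> M" using one_closed unfolding K_def by blast+
    then show "x \<in> M" by simp
  qed
  have largest: "N \<subseteq> K" if "N \<lhd> G" "N \<subseteq> M" for N
    using that normal.inv_op_closed2[OF that(1)] subgroup.mem_carrier[OF normal_imp_subgroup[OF that(1)]]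
    unfolding K_def by blast
  have "K \<lhd> G"
    unfolding normal_inv_iff
  proof (intro conjI ballI)
    show "subgroup K G"
    proof (rule subgroupI)
      show "K \<subseteq> carrier G" by (auto simp: K_def)
      show "K \<noteq> {}" using subgroup.one_closed[OF M(1)] by (auto simp: K_def intro!: exI[of _ \<one>])
    next
      fix a assume a: "a \<in> K"
      have "g \<otimes> inv a \<otimes> inv g = inv (g \<otimes> a \<otimes> inv g)" if "g \<in> carrier G" for g
        using a that by (simp add: K_def inv_mult_group m_assoc)
      then show "inv a \<in> K"
        using a subgroup.m_inv_closed[OF M(1)] by (simp add: K_def)
    next
      fix a b assume ab: "a \<in> K" "b \<in> K"
      have "g \<otimes> (a \<otimes> b) \<otimes> inv g = (g \<otimes> a \<otimes> inv g) \<otimes> (g \<otimes> b \<otimes> inv g)" if "g \<in> carrier G" for g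
        using ab that by (simp add: K_def m_assoc inv_cancel)
      then show "a \<otimes> b \<in> K"
        using ab subgroup.m_closed[OF M(1)] by (simp add: K_def)
    qed
    fix g a assume ga: "g \<in> carrier G" "a \<in> K"
    have "f \<otimes> (g \<otimes> a \<otimes> inv g) \<otimes> inv f = (f \<otimes> g) \<otimes> a \<otimes> inv (f \<otimes> g)" if "f \<in> carrier G" for f
      using ga that by (simp add: K_def inv_mult_group m_assoc)
    then show "g \<otimes> a \<otimes> inv g \<in> K" using ga by (simp add: K_def)
  qed
  then interpret K: normal K G .
  interpret Q: group "G Mod K" by (rule K.factorgroup_is_group)
  let ?p = "\<lambda>x. K #> x"
  interpret p: group_hom G "G Mod K" ?p
    using K.r_coset_hom_Mod by unfold_locales
  have surj: "?p ` carrier G = carrier (G Mod K)" by (simp add: carrier_FactGroup)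
  have image_vimage: "?p ` {x \<in> carrier G. ?p x \<in> H} = H" if "H \<subseteq> carrier (G Mod K)" for H
  proof (rule subset_antisym)
    have "H \<subseteq> ?p ` carrier G" using that surj by simp
    then show "H \<subseteq> ?p ` {x \<in> carrier G. ?p x \<in> H}" by blast
  qed blast
  have p_one: "?p x = \<one>\<^bsub>G Mod K\<^esub> \<longleftrightarrow> x \<in> K" if "x \<in> carrier G" for x
    using K.r_coset_eq_iff[OF that one_closed] that K.subset by simp
  have p_M: "x \<in> M" if x: "x \<in> carrier G" and px: "?p x \<in> ?p ` M" for x
  proof -
    obtain m where m: "m \<in> M" "?p x = ?p m" using px by blast
    then have "x \<otimes> inv m \<in> M" using K.r_coset_eq_iff[OF x, of m] MG K_M by blast
    then have "x \<otimes> inv m \<otimes> m \<in> M" using subgroup.m_closed[OF M(1) _ m(1)] by blast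
    then show ?thesis using x m MG by (simp add: m_assoc subset_iff)
  qed
  have "\<not> carrier G \<subseteq> K" using K_M M MG by blast
  then obtain N A where NA: "N \<lhd> G" "A \<lhd> G" "N \<subseteq> K" "\<not> A \<subseteq> K" "cyclic_over G N A"
    using supersoluble_above_leaves[OF above, of K] K.one_closed by blast
  then obtain b where b: "b \<in> A" "\<And>c. c \<in> A \<Longrightarrow> \<exists>k::int. c \<otimes> inv (b [^] k) \<in> N"
    unfolding cyclic_over_def by blast
  have sA: "subgroup A G" using NA(2) by (rule normal_imp_subgroup)
  have AG: "x \<in> carrier G" if "x \<in> A" for x using subgroup.mem_carrier[OF sA that] .
  interpret P: primitive_cyclic "G Mod K" "?p ` M" "?p ` A" "?p b"
  proof (intro primitive_cyclic.intro primitive_cyclic_axioms.intro)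
    show "group (G Mod K)" by (rule Q.is_group)
    show "subgroup (?p ` M) (G Mod K)" by (rule p.subgroup_img_is_subgroup[OF M(1)])
    show "?p ` M \<noteq> carrier (G Mod K)"
    proof
      assume "?p ` M = carrier (G Mod K)"
      then have "carrier G \<subseteq> M" using p_M p.hom_closed by (metis subsetI)
      then show False using M(2) MG by auto
    qed
    show "?p ` A \<lhd> G Mod K"
      by (rule normal.surj_hom_normal_subgroup[OF NA(2) p.group_hom_axioms surj])
    show "?p ` A \<noteq> {\<one>\<^bsub>G Mod K\<^esub>}"
    proof
      assume "?p ` A = {\<one>\<^bsub>G Mod K\<^esub>}"
      then have "A \<subseteq> K" using p_one AG by (metis imageI singletonD subsetI)
      then show False using NA(4) by simp
    qed
    show "?p b \<in> carrier (G Mod K)" using AG[OF b(1)] by simp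
    show "?p ` A = range (\<lambda>k::int. ?p b [^]\<^bsub>G Mod K\<^esub> k)"
    proof -
      have "?p b [^]\<^bsub>G Mod K\<^esub> k = ?p (b [^] k)" for k :: int
        using AG[OF b(1)] p.hom_int_pow by simp
      moreover have "b [^] k \<in> A" for k :: int by (rule subgroup_int_pow_closed[OF sA b(1)])
      moreover have "\<exists>k::int. ?p c = ?p (b [^] k)" if "c \<in> A" for c
        using b(2)[OF that] NA(3) K.r_coset_eq_iff[OF AG[OF that]] AG[OF b(1)]
        by (metis int_pow_closed subsetD)
      ultimately show ?thesis by (intro subset_antisym subsetI) (auto, metis rangeI)
    qed
  next
    fix H assume H: "subgroup H (G Mod K)" "?p ` M \<subseteq> H" "H \<noteq> ?p ` M"
    define H' where "H' = {x \<in> carrier G. ?p x \<in> H}"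
    have "subgroup H' G"
      unfolding H'_def by (rule p.subgroup_vimage[OF H(1)])
    moreover have "M \<subseteq> H'" using H(2) MG by (auto simp: H'_def)
    moreover have image: "?p ` H' = H"
      unfolding H'_def by (rule image_vimage[OF subgroup.subset[OF H(1)]])
    ultimately have "H' = carrier G" using maximal[of H'] H(3) by blast
    then show "H = carrier (G Mod K)" using image surj by simp
  next
    fix N assume N: "N \<lhd> G Mod K" "N \<subseteq> ?p ` M"
    define N' where "N' = {x \<in> carrier G. ?p x \<in> N}"
    have "N' \<lhd> G" unfolding N'_def by (rule p.normal_vimage[OF N(1)])
    moreover have "N' \<subseteq> M" using N(2) p_M by (auto simp: N'_def)
    ultimately have "N' \<subseteq> K" by (rule largest)
    moreover have "?p ` N' = N"
      unfolding N'_def by (rule image_vimage[OF subgroup.subset[OF normal_imp_subgroup[OF N(1)]]])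
    ultimately have "N \<subseteq> {\<one>\<^bsub>G Mod K\<^esub>}" using p_one K.subset by (metis imageE singletonI subsetD subsetI)
    then show "N = {\<one>\<^bsub>G Mod K\<^esub>}"
      using subgroup.one_closed[OF normal_imp_subgroup[OF N(1)]] by blast
  qed
  have conj: "\<exists>g\<in>carrier (G Mod K). inv\<^bsub>G Mod K\<^esub> g \<otimes>\<^bsub>G Mod K\<^esub> ?p s \<otimes>\<^bsub>G Mod K\<^esub> g \<in> ?p ` M"
    if s: "s \<in> carrier G" and g: "\<exists>g\<in>carrier G. inv g \<otimes> s \<otimes> g \<in> L" for s
  proof -
    obtain g where g: "g \<in> carrier G" "inv g \<otimes> s \<otimes> g \<in> L" using g by blast
    have "inv\<^bsub>G Mod K\<^esub> (?p g) \<otimes>\<^bsub>G Mod K\<^esub> ?p s \<otimes>\<^bsub>G Mod K\<^esub> ?p g = ?p (inv g \<otimes> s \<otimes> g)"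
      using g(1) s by (simp del: mult_FactGroup)
    moreover have "?p (inv g \<otimes> s \<otimes> g) \<in> ?p ` M" using g(2) M(3) by blast
    ultimately show ?thesis by (intro bexI[OF _ p.hom_closed[OF g(1)]]) (simp only:)
  qed
  have "card (?p ` A) \<le> n"
  proof -
    have "A \<subseteq> carrier G" using AG by blast
    then have "card A \<le> n" "finite A"
      using card_mono[OF fin, of A] n finite_subset[OF _ fin, of A] unfolding order_def by linarith+
    then show ?thesis using card_image_le[of A ?p] by linarith
  qed
  show False
  proof (rule P.generators_or_witnesses_avoid_conjugates[where xs = "map ?p xs" and n = n])
    show "set (map ?p xs) \<subseteq> carrier (G Mod K)" using xs(1) by auto
    show "generate (G Mod K) (set (map ?p xs)) = carrier (G Mod K)"
      using p.generate_img[OF xs(1)] xs(2) surj by simp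
    show "finite (?p ` A)" using fin AG by (meson finite_imageI finite_subset subsetI)
    show "card (?p ` A) \<le> n" by fact
  next
    fix y assume "y \<in> set (map ?p xs)"
    then show "\<exists>g\<in>carrier (G Mod K). inv\<^bsub>G Mod K\<^esub> g \<otimes>\<^bsub>G Mod K\<^esub> y \<otimes>\<^bsub>G Mod K\<^esub> g \<in> ?p ` M"
      using conj gens xs(1) by auto
  next
    fix us' y vs' assume "map ?p xs = us' @ y # vs'"
    then obtain us x vs where split: "xs = us @ x # vs" "us' = map ?p us" "y = ?p x"
      by (auto simp: map_eq_append_conv map_eq_Cons_conv)
    have car: "set us \<subseteq> carrier G" "x \<in> carrier G" using xs(1) split(1) by auto
    show "\<exists>g\<in>carrier (G Mod K). inv\<^bsub>G Mod K\<^esub> g \<otimes>\<^bsub>G Mod K\<^esub> witness (G Mod K) n us' y \<otimes>\<^bsub>G Mod K\<^esub> g \<in> ?p ` M"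
      using conj[OF witness_closed[OF car] wits[OF split(1)]] p.hom_witness[OF car]
      by (simp only: split(2,3))
  qed
qed

section \<open>Density and closed subgroups in pro-completions\<close>

text \<open>The choice of representatives defines a point of the inverse limit only if it is compatible
  with the canonical maps, which has to be shown in each case. Constant choices give the canonical map from
  \<open>G\<close> to its completion.\<close>

definition pro_element ::
    "('a set monoid \<Rightarrow> bool) \<Rightarrow> ('a, 'b) monoid_scheme \<Rightarrow> ('a set \<Rightarrow> 'a) \<Rightarrow> 'a set \<Rightarrow> 'a set" where
  "pro_element C G a = (\<lambda>N\<in>quotient_kernels C G. N #>\<^bsub>G\<^esub> a N)"

context group
begin

lemma quotient_kernels_normal: "N \<in> quotient_kernels C G \<Longrightarrow> N \<lhd> G"
  by (simp add: quotient_kernels_def)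

lemma carrier_pro_completion_iff:
  "x \<in> carrier (pro_completion C G) \<longleftrightarrow>
     x \<in> (\<Pi>\<^sub>E N\<in>quotient_kernels C G. carrier (G Mod N)) \<and>
     (\<forall>N\<in>quotient_kernels C G. \<forall>M\<in>quotient_kernels C G. N \<subseteq> M \<longrightarrow> M <#> x N = x M)"
  by (simp add: pro_completion_def)

lemma pro_element_closed:
  assumes "\<And>N. N \<in> quotient_kernels C G \<Longrightarrow> a N \<in> carrier G"
    and "\<And>N M. N \<in> quotient_kernels C G \<Longrightarrow> M \<in> quotient_kernels C G \<Longrightarrow> N \<subseteq> M \<Longrightarrow>
           M #> a N = M #> a M"
  shows "pro_element C G a \<in> carrier (pro_completion C G)"
  unfolding carrier_pro_completion_iff
proof (intro conjI ballI impI)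
  show "pro_element C G a \<in> (\<Pi>\<^sub>E N\<in>quotient_kernels C G. carrier (G Mod N))"
    using assms(1) by (auto simp: pro_element_def carrier_FactGroup)
next
  fix N M assume NM: "N \<in> quotient_kernels C G" "M \<in> quotient_kernels C G" "N \<subseteq> M"
  have "M <#> (N #> a N) = M #> a N"
    using NM assms(1) by (intro normal_set_mult_rcos quotient_kernels_normal)
  also have "\<dots> = M #> a M" using NM by (rule assms(2))
  finally show "M <#> pro_element C G a N = pro_element C G a M"
    using NM by (simp add: pro_element_def)
qed

lemma pro_element_const_closed:
  "g \<in> carrier G \<Longrightarrow> pro_element C G (\<lambda>_. g) \<in> carrier (pro_completion C G)"
  by (rule pro_element_closed) auto

lemma pro_projection_hom:
  assumes N: "N \<in> quotient_kernels C G"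
  shows "group_hom (pro_completion C G) (G Mod N) (\<lambda>x. x N)"
proof -
  interpret F: group "pro_completion C G" by (rule group_pro_completion[OF is_group])
  interpret Q: group "G Mod N"
    using quotient_kernels_normal[OF N] by (rule normal.factorgroup_is_group)
  have "(\<lambda>x. x N) \<in> hom (pro_completion C G) (G Mod N)"
    using N by (intro homI) (auto simp: carrier_pro_completion_iff pro_completion_def PiE_iff)
  then show ?thesis by unfold_locales
qed

lemma pro_completion_coset:
  assumes "x \<in> carrier (pro_completion C G)" "N \<in> quotient_kernels C G"
  obtains w where "w \<in> carrier G" "x N = N #> w"
proof -
  have "x N \<in> carrier (G Mod N)" using assms by (auto simp: carrier_pro_completion_iff PiE_iff)
  then show thesis using that by (auto simp: carrier_FactGroup)
qed

lemma pro_completion_coarser: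
  assumes "x \<in> carrier (pro_completion C G)" "N \<in> quotient_kernels C G" "M \<in> quotient_kernels C G"
    "N \<subseteq> M" "w \<in> carrier G" "x N = N #> w"
  shows "x M = M #> w"
  using assms normal_set_mult_rcos[of N M w] quotient_kernels_normal
  by (auto simp: carrier_pro_completion_iff)

lemma pro_dense:
  assumes A: "A \<subseteq> carrier (pro_completion C G)"
    and approx: "\<And>x F. x \<in> carrier (pro_completion C G) \<Longrightarrow> finite F \<Longrightarrow> F \<subseteq> quotient_kernels C G \<Longrightarrow>
      \<exists>a\<in>A. \<forall>N\<in>F. a N = x N"
  shows "pro_topology C G closure_of A = carrier (pro_completion C G)"
proof
  show "pro_topology C G closure_of A \<subseteq> carrier (pro_completion C G)"
    using closure_of_subset_topspace[of "pro_topology C G" A] by (simp add: topspace_pro_topology)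
  show "carrier (pro_completion C G) \<subseteq> pro_topology C G closure_of A"
  proof
    fix x assume x: "x \<in> carrier (pro_completion C G)"
    have "\<exists>y\<in>A. y \<in> U" if U: "x \<in> U" "openin (pro_topology C G) U" for U
    proof -
      obtain V where V: "openin (product_topology (\<lambda>N. discrete_topology (carrier (G Mod N))) (quotient_kernels C G)) V"
        "U = V \<inter> carrier (pro_completion C G)"
        using U(2) by (auto simp: pro_topology_def openin_subtopology)
      then have "x \<in> V" using U(1) by simp
      then obtain W where W: "finite {N \<in> quotient_kernels C G. W N \<noteq> carrier (G Mod N)}"
        "x \<in> Pi\<^sub>E (quotient_kernels C G) W" "Pi\<^sub>E (quotient_kernels C G) W \<subseteq> V"
        using V(1) unfolding openin_product_topology_alt by force
      obtain a where a: "a \<in> A" "\<forall>N\<in>{N \<in> quotient_kernels C G. W N \<noteq> carrier (G Mod N)}. a N = x N"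
        using approx[OF x W(1)] by auto
      have aF: "a \<in> carrier (pro_completion C G)" using a(1) A by blast
      have "a N \<in> W N" if N: "N \<in> quotient_kernels C G" for N
      proof (cases "W N = carrier (G Mod N)")
        case True
        then show ?thesis using aF N by (auto simp: carrier_pro_completion_iff PiE_iff)
      next
        case False
        then show ?thesis using a(2) N W(2) by (auto simp: PiE_iff)
      qed
      then have "a \<in> Pi\<^sub>E (quotient_kernels C G) W"
        using aF by (auto simp: carrier_pro_completion_iff PiE_iff)
      then show ?thesis using W(3) V(2) aF a(1) by blast
    qed
    then show "x \<in> pro_topology C G closure_of A"
      using x by (auto simp: in_closure_of topspace_pro_topology)
  qed
qed

lemma pro_closedin_projection:
  assumes N: "N \<in> quotient_kernels C G"
  shows "closedin (pro_topology C G) {x \<in> carrier (pro_completion C G). x N \<in> B}"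
proof -
  have cont: "continuous_map (pro_topology C G) (discrete_topology (carrier (G Mod N))) (\<lambda>x. x N)"
    unfolding pro_topology_def
    using continuous_map_product_projection[OF N, of "\<lambda>N. discrete_topology (carrier (G Mod N))"]
    by (rule continuous_map_from_subtopology)
  have "closedin (pro_topology C G)
          {x \<in> topspace (pro_topology C G). x N \<in> B \<inter> carrier (G Mod N)}"
    by (rule closedin_continuous_map_preimage[OF cont]) simp
  moreover have "{x \<in> topspace (pro_topology C G). x N \<in> B \<inter> carrier (G Mod N)} =
                 {x \<in> carrier (pro_completion C G). x N \<in> B}"
    using N by (auto simp: topspace_pro_topology carrier_pro_completion_iff PiE_iff)
  ultimately show ?thesis by simp
qed

text \<open>The conjugating elements of \<open>G\<close> also conjugate in the completion, and they move all of \<open>S\<close> into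
  the preimage of \<open>L / N\<close>. This preimage is a closed subgroup, being defined by one coordinate, and a
  proper one, since the image of \<open>G\<close> meets its complement.\<close>

lemma not_invariably_generates_if_conjugate_into:
  assumes N: "N \<in> quotient_kernels C G" and L: "subgroup L G" "N \<subseteq> L" "L \<noteq> carrier G"
    and S: "\<And>s. s \<in> S \<Longrightarrow> \<exists>w\<in>carrier G. \<exists>g\<in>carrier G. s N = N #> w \<and> inv g \<otimes> w \<otimes> g \<in> L"
  shows "\<not> invariably_generates (pro_completion C G) (pro_topology C G) S"
proof
  let ?F = "pro_completion C G"
  assume inv_gen: "invariably_generates ?F (pro_topology C G) S"
  then have SF: "S \<subseteq> carrier ?F" by (simp add: invariably_generates_def)
  interpret F: group ?F by (rule group_pro_completion[OF is_group])
  interpret N: normal N G by (rule quotient_kernels_normal[OF N])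
  interpret \<pi>: group_hom ?F "G Mod N" "\<lambda>x. x N" by (rule pro_projection_hom[OF N])
  interpret Q: group "G Mod N" by (rule N.factorgroup_is_group)
  interpret p: group_hom G "G Mod N" "\<lambda>x. N #> x"
    using N.r_coset_hom_Mod by unfold_locales
  obtain w g where wg: "\<And>s. s \<in> S \<Longrightarrow> w s \<in> carrier G" "\<And>s. s \<in> S \<Longrightarrow> g s \<in> carrier G"
    "\<And>s. s \<in> S \<Longrightarrow> s N = N #> w s" "\<And>s. s \<in> S \<Longrightarrow> inv (g s) \<otimes> w s \<otimes> g s \<in> L"
    using S by metis
  define \<gamma> where "\<gamma> s = pro_element C G (\<lambda>_. g s)" for s
  have \<gamma>: "\<gamma> s \<in> carrier ?F" "\<gamma> s N = N #> g s" if "s \<in> S" for s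
    unfolding \<gamma>_def using pro_element_const_closed[OF wg(2)[OF that]] N by (simp_all add: pro_element_def)
  define P where "P = {x \<in> carrier ?F. x N \<in> (\<lambda>a. N #> a) ` L}"
  have sL: "subgroup ((\<lambda>a. N #> a) ` L) (G Mod N)" by (rule p.subgroup_img_is_subgroup[OF L(1)])
  have "subgroup P ?F"
  proof (rule F.subgroupI)
    show "P \<subseteq> carrier ?F" by (auto simp: P_def)
    show "P \<noteq> {}"
      using subgroup.one_closed[OF sL] \<pi>.hom_one F.one_closed unfolding P_def by fastforce
    show "inv\<^bsub>?F\<^esub> x \<in> P" if "x \<in> P" for x
      using that subgroup.m_inv_closed[OF sL] by (simp add: P_def)
    show "x \<otimes>\<^bsub>?F\<^esub> y \<in> P" if "x \<in> P" "y \<in> P" for x y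
      using that subgroup.m_closed[OF sL] by (simp add: P_def del: mult_FactGroup)
  qed
  moreover have "(\<lambda>s. inv\<^bsub>?F\<^esub> (\<gamma> s) \<otimes>\<^bsub>?F\<^esub> s \<otimes>\<^bsub>?F\<^esub> \<gamma> s) ` S \<subseteq> P"
  proof (rule image_subsetI)
    fix s assume s: "s \<in> S"
    have sF: "s \<in> carrier ?F" using s SF by blast
    have "(inv\<^bsub>?F\<^esub> (\<gamma> s) \<otimes>\<^bsub>?F\<^esub> s \<otimes>\<^bsub>?F\<^esub> \<gamma> s) N = N #> (inv (g s) \<otimes> w s \<otimes> g s)"
      using sF \<gamma>[OF s] wg(1-3)[OF s] by (simp del: mult_FactGroup)
    then show "inv\<^bsub>?F\<^esub> (\<gamma> s) \<otimes>\<^bsub>?F\<^esub> s \<otimes>\<^bsub>?F\<^esub> \<gamma> s \<in> P"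
      using sF \<gamma>(1)[OF s] wg(4)[OF s] by (simp add: P_def del: mult_FactGroup)
  qed
  ultimately have "generate ?F ((\<lambda>s. inv\<^bsub>?F\<^esub> (\<gamma> s) \<otimes>\<^bsub>?F\<^esub> s \<otimes>\<^bsub>?F\<^esub> \<gamma> s) ` S) \<subseteq> P"
    by (intro F.generate_subgroup_incl)
  moreover have "closedin (pro_topology C G) P"
    unfolding P_def by (rule pro_closedin_projection[OF N])
  ultimately have "pro_topology C G closure_of
      generate ?F ((\<lambda>s. inv\<^bsub>?F\<^esub> (\<gamma> s) \<otimes>\<^bsub>?F\<^esub> s \<otimes>\<^bsub>?F\<^esub> \<gamma> s) ` S) \<subseteq> P"
    by (rule closure_of_minimal)
  moreover have "\<gamma> \<in> S \<rightarrow> carrier ?F" using \<gamma>(1) by blast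
  ultimately have all: "carrier ?F \<subseteq> P"
    using inv_gen by (auto simp: invariably_generates_def top_generates_def)
  obtain b where b: "b \<in> carrier G" "b \<notin> L" using L(1,3) subgroup.subset by blast
  have "pro_element C G (\<lambda>_. b) \<in> P" using all pro_element_const_closed[OF b(1)] by blast
  then have "N #> b \<in> (\<lambda>a. N #> a) ` L" using N by (simp add: P_def pro_element_def)
  then obtain l where l: "l \<in> L" "N #> b = N #> l" by blast
  have lG: "l \<in> carrier G" using subgroup.mem_carrier[OF L(1) l(1)] .
  have "b \<otimes> inv l \<in> L" using l(2) N.r_coset_eq_iff[OF b(1) lG] L(2) by blast
  then have "b \<otimes> inv l \<otimes> l \<in> L" using subgroup.m_closed[OF L(1) _ l(1)] by blast
  then show False using b lG by (simp add: m_assoc)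
qed

lemma order_quotient_mono:
  assumes "N \<lhd> G" "M \<lhd> G" "N \<subseteq> M" "finite (carrier (G Mod N))"
  shows "order (G Mod M) \<le> order (G Mod N)"
proof -
  have "carrier (G Mod M) = (\<lambda>X. M <#> X) ` carrier (G Mod N)"
    using normal_set_mult_rcos[OF assms(1-3)] by (auto simp: carrier_FactGroup image_image)
  then show ?thesis using card_image_le[OF assms(4), of "\<lambda>X. M <#> X"] by (simp add: order_def)
qed

text \<open>Unlike the witnesses of an abstract group, this limit does not have to come from a single word:
  the parameter of the word grows with the order of the finite quotient.\<close>

definition pro_witness :: "'a list \<Rightarrow> 'a \<Rightarrow> 'a set \<Rightarrow> 'a set" where
  "pro_witness us x = pro_element finite_supersoluble G (\<lambda>N. witness G (order (G Mod N)) us x)"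

lemma witness_coset:
  assumes "N \<lhd> G" "set us \<subseteq> carrier G" "x \<in> carrier G"
  shows "N #> witness G n us x = witness (G Mod N) n (map (\<lambda>x. N #> x) us) (N #> x)"
proof -
  interpret N: normal N G by (rule assms)
  interpret Q: group "G Mod N" by (rule N.factorgroup_is_group)
  interpret p: group_hom G "G Mod N" "\<lambda>x. N #> x"
    using N.r_coset_hom_Mod by unfold_locales
  show ?thesis by (rule p.hom_witness[OF assms(2,3)])
qed

lemma pro_witness_closed:
  assumes car: "set us \<subseteq> carrier G" "x \<in> carrier G"
  shows "pro_witness us x \<in> carrier (pro_completion finite_supersoluble G)"
  unfolding pro_witness_def
proof (rule pro_element_closed)
  fix N M assume NM: "N \<in> quotient_kernels finite_supersoluble G"
    "M \<in> quotient_kernels finite_supersoluble G" "N \<subseteq> M"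
  interpret M: normal M G by (rule quotient_kernels_normal[OF NM(2)])
  interpret Q: group "G Mod M" by (rule M.factorgroup_is_group)
  have fin: "finite (carrier (G Mod M))" "finite (carrier (G Mod N))"
    using NM by (auto simp: quotient_kernels_iff)
  have "order (G Mod M) \<le> order (G Mod N)"
    using NM fin quotient_kernels_normal by (intro order_quotient_mono) auto
  moreover have "set (map (\<lambda>x. M #> x) us) \<subseteq> carrier (G Mod M)" "M #> x \<in> carrier (G Mod M)"
    using car by (auto simp: carrier_FactGroup)
  ultimately have "witness (G Mod M) (order (G Mod N)) (map (\<lambda>x. M #> x) us) (M #> x) =
      witness (G Mod M) (order (G Mod M)) (map (\<lambda>x. M #> x) us) (M #> x)"
    by (rule Q.witness_stable[OF fin(1)])
  then show "M #> witness G (order (G Mod N)) us x = M #> witness G (order (G Mod M)) us x"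
    by (simp only: witness_coset[OF M.normal_axioms car])
qed (use car in simp)

text \<open>Finitely many coordinates factor through one finite supersoluble quotient, and there the conjugated
  elements cannot all lie in a proper subgroup. The witness for the first generator is trivial, so the
  index \<open>0\<close> is left out, which saves one element.\<close>

theorem generators_and_pro_witnesses_invariably_generate:
  assumes xs: "set xs \<subseteq> carrier G" "generate G (set xs) = carrier G"
  shows "invariably_generates (pro_completion finite_supersoluble G) (pro_topology finite_supersoluble G)
    ((\<lambda>x. pro_element finite_supersoluble G (\<lambda>_. x)) ` set xs \<union>
     (\<lambda>i. pro_witness (take i xs) (xs ! i)) ` {1..<length xs})" (is "invariably_generates ?F _ ?S")
  unfolding invariably_generates_def top_generates_def
proof (intro conjI allI impI)
  interpret F: group ?F by (rule group_pro_completion[OF is_group])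
  have take: "set (take i xs) \<subseteq> carrier G" for i using xs(1) set_take_subset[of i xs] by blast
  show SF: "?S \<subseteq> carrier ?F"
    using xs(1) take by (auto intro!: pro_element_const_closed pro_witness_closed)
  fix \<gamma> assume \<gamma>: "\<gamma> \<in> ?S \<rightarrow> carrier ?F"
  let ?c = "\<lambda>s. inv\<^bsub>?F\<^esub> (\<gamma> s) \<otimes>\<^bsub>?F\<^esub> s \<otimes>\<^bsub>?F\<^esub> \<gamma> s"
  show cF: "?c ` ?S \<subseteq> carrier ?F"
  proof (rule image_subsetI)
    fix s assume "s \<in> ?S"
    then have "s \<in> carrier ?F" "\<gamma> s \<in> carrier ?F" using SF \<gamma> by (blast, blast)
    then show "?c s \<in> carrier ?F" by simp
  qed
  show "pro_topology finite_supersoluble G closure_of generate ?F (?c ` ?S) = carrier ?F"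
  proof (rule pro_dense)
    show "generate ?F (?c ` ?S) \<subseteq> carrier ?F" by (rule F.generate_incl[OF cF])
    fix x \<F> assume x: "x \<in> carrier ?F" and \<F>: "finite \<F>" "\<F> \<subseteq> quotient_kernels finite_supersoluble G"
    obtain N where N: "N \<in> quotient_kernels finite_supersoluble G" "\<And>M. M \<in> \<F> \<Longrightarrow> N \<subseteq> M"
      using quotient_kernels_Inter[OF \<F>] by blast
    interpret N: normal N G by (rule quotient_kernels_normal[OF N(1)])
    interpret Q: group "G Mod N" by (rule N.factorgroup_is_group)
    interpret p: group_hom G "G Mod N" "\<lambda>x. N #> x"
      using N.r_coset_hom_Mod by unfold_locales
    interpret \<pi>: group_hom ?F "G Mod N" "\<lambda>x. x N" by (rule pro_projection_hom[OF N(1)])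
    let ?L = "(\<lambda>x. x N) ` generate ?F (?c ` ?S)"
    have L: "subgroup ?L (G Mod N)"
      by (rule \<pi>.subgroup_img_is_subgroup[OF F.generate_is_subgroup[OF cF]])
    have conj: "\<exists>g\<in>carrier (G Mod N). inv\<^bsub>G Mod N\<^esub> g \<otimes>\<^bsub>G Mod N\<^esub> s N \<otimes>\<^bsub>G Mod N\<^esub> g \<in> ?L"
      if s: "s \<in> ?S" for s
    proof -
      have sF: "s \<in> carrier ?F" "\<gamma> s \<in> carrier ?F" using s SF \<gamma> by (blast, blast)
      have "?c s \<in> generate ?F (?c ` ?S)" using s by (intro generate.incl imageI)
      then have "?c s N \<in> ?L" by (rule imageI)
      moreover have "?c s N = inv\<^bsub>G Mod N\<^esub> (\<gamma> s N) \<otimes>\<^bsub>G Mod N\<^esub> s N \<otimes>\<^bsub>G Mod N\<^esub> \<gamma> s N"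
        using sF by (simp del: mult_FactGroup)
      ultimately show ?thesis by (intro bexI[OF _ \<pi>.hom_closed[OF sF(2)]]) (simp only:)
    qed
    have "?L = carrier (G Mod N)"
    proof (rule Q.generators_and_witnesses_not_in_proper_subgroup
        [where xs = "map (\<lambda>x. N #> x) xs" and n = "order (G Mod N)"])
      show "finite_supersoluble (G Mod N)" using N(1) by (simp add: quotient_kernels_def)
      show "set (map (\<lambda>x. N #> x) xs) \<subseteq> carrier (G Mod N)" using xs(1) by auto
      show "generate (G Mod N) (set (map (\<lambda>x. N #> x) xs)) = carrier (G Mod N)"
        using p.generate_img[OF xs(1)] xs(2) by (simp add: carrier_FactGroup)
    next
      fix y assume "y \<in> set (map (\<lambda>x. N #> x) xs)"
      then obtain u where u: "u \<in> set xs" "y = N #> u" by auto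
      then have "pro_element finite_supersoluble G (\<lambda>_. u) N = y"
        using N(1) by (simp add: pro_element_def)
      then show "\<exists>g\<in>carrier (G Mod N). inv\<^bsub>G Mod N\<^esub> g \<otimes>\<^bsub>G Mod N\<^esub> y \<otimes>\<^bsub>G Mod N\<^esub> g \<in> ?L"
        using conj[of "pro_element finite_supersoluble G (\<lambda>_. u)"] u(1) by blast
    next
      fix us' y vs' assume "map (\<lambda>x. N #> x) xs = us' @ y # vs'"
      then obtain us u vs where split: "xs = us @ u # vs" "us' = map (\<lambda>x. N #> x) us" "y = N #> u"
        by (auto simp: map_eq_append_conv map_eq_Cons_conv)
      show "\<exists>g\<in>carrier (G Mod N). inv\<^bsub>G Mod N\<^esub> g \<otimes>\<^bsub>G Mod N\<^esub>
              witness (G Mod N) (order (G Mod N)) us' y \<otimes>\<^bsub>G Mod N\<^esub> g \<in> ?L"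
      proof (cases "us = []")
        case True
        then have "witness (G Mod N) (order (G Mod N)) us' y = \<one>\<^bsub>G Mod N\<^esub>" using split(2) by simp
        then show ?thesis
          using subgroup.one_closed[OF L]
          by (intro bexI[OF _ Q.one_closed]) (simp del: mult_FactGroup one_FactGroup)
      next
        case False
        have car: "set us \<subseteq> carrier G" "u \<in> carrier G" using xs(1) split(1) by auto
        have "pro_witness (take (length us) xs) (xs ! length us) = pro_witness us u"
          using split(1) by simp
        moreover have "length us \<in> {1..<length xs}" using split(1) False by (simp add: Suc_le_eq)
        ultimately have "pro_witness us u \<in> ?S"
          by (intro UnI2 image_eqI[where x = "length us"]) (simp only:)+
        note conj[OF this]
        moreover have "pro_witness us u N = N #> witness G (order (G Mod N)) us u"
          using N(1) by (simp add: pro_witness_def pro_element_def)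
        ultimately show ?thesis
          by (simp only: witness_coset[OF N.normal_axioms car] split(2,3))
      qed
    qed (use L in auto)
    moreover have "x N \<in> carrier (G Mod N)" by (rule \<pi>.hom_closed[OF x])
    ultimately have "x N \<in> ?L" by (simp only:)
    then obtain a where a: "a \<in> generate ?F (?c ` ?S)" "a N = x N" by (elim imageE) simp
    have aF: "a \<in> carrier ?F" using F.generate_incl[OF cF] a(1) by blast
    have "a M = x M" if "M \<in> \<F>" for M
    proof -
      have "M <#> a N = a M" "M <#> x N = x M"
        using aF x N(1) N(2)[OF that] \<F>(2) that by (auto simp: carrier_pro_completion_iff)
      then show ?thesis using a(2) by simp
    qed
    then show "\<exists>a\<in>generate ?F (?c ` ?S). \<forall>M\<in>\<F>. a M = x M" using a(1) by blast
  qed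
qed

end

section \<open>Shattered sets of coordinates\<close>

text \<open>In the language of vector spaces over the field with two elements, a subspace with at least \<open>2\<^sup>d\<close>
  vectors maps onto some \<open>d\<close> of its coordinates. In the induction, half of the sets avoid a given element
  \<open>a\<close> that occurs in some set \<open>C\<close>; forming the symmetric difference with \<open>C\<close> adds the coordinate \<open>a\<close> to
  those shattered by the sets that avoid \<open>a\<close>.\<close>

lemma shattered_set:
  fixes \<U> :: "'a set set"
  assumes "\<And>A B. A \<in> \<U> \<Longrightarrow> B \<in> \<U> \<Longrightarrow> sym_diff A B \<in> \<U>" "2 ^ d \<le> card \<U>"
  shows "\<exists>I. finite I \<and> card I = d \<and> (\<forall>J\<subseteq>I. \<exists>A\<in>\<U>. A \<inter> I = J)"
  using assms
proof (induction d arbitrary: \<U>)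
  case 0
  then have "\<U> \<noteq> {}" by auto
  then show ?case by (intro exI[of _ "{}"]) auto
next
  case (Suc d)
  have fin: "finite \<U>" using Suc.prems(2) by (intro card_ge_0_finite) (auto intro: less_le_trans[of 0 "2 ^ Suc d"])
  have "\<not> \<U> \<subseteq> {{}}"
  proof
    assume "\<U> \<subseteq> {{}}"
    then have "card \<U> \<le> 1" using card_mono[of "{{}}" \<U>] by simp
    moreover have "(2::nat) \<le> 2 ^ Suc d" by simp
    ultimately show False using Suc.prems(2) by linarith
  qed
  then obtain C a where C: "C \<in> \<U>" "a \<in> C" by auto
  define \<V> where "\<V> = {A \<in> \<U>. a \<notin> A}"
  have "sym_diff C ` (\<U> - \<V>) \<subseteq> \<V>" using Suc.prems(1) C by (auto simp: \<V>_def)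
  moreover have "inj_on (sym_diff C) (\<U> - \<V>)" by (auto simp: inj_on_def)
  ultimately have "card (\<U> - \<V>) \<le> card \<V>"
    using fin by (intro card_inj_on_le) (auto simp: \<V>_def)
  moreover have "\<V> \<subseteq> \<U>" by (auto simp: \<V>_def)
  then have "card (\<U> - \<V>) = card \<U> - card \<V>"
    using fin by (intro card_Diff_subset) (auto intro: finite_subset)
  ultimately have "2 ^ d \<le> card \<V>" using Suc.prems(2) by simp
  then obtain I where I: "finite I" "card I = d" "\<And>J. J \<subseteq> I \<Longrightarrow> \<exists>A\<in>\<V>. A \<inter> I = J"
    using Suc.IH[of \<V>] Suc.prems(1) by (fastforce simp: \<V>_def)
  have "a \<notin> I" using I(3)[of I] by (auto simp: \<V>_def)
  moreover have "\<exists>A\<in>\<U>. A \<inter> insert a I = J" if J: "J \<subseteq> insert a I" for J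
  proof (cases "a \<in> J")
    case False
    then obtain A where "A \<in> \<V>" "A \<inter> I = J" using I(3)[of J] J by blast
    then show ?thesis by (intro bexI[of _ A]) (auto simp: \<V>_def)
  next
    case True
    obtain A where A: "A \<in> \<V>" "A \<inter> I = sym_diff J C \<inter> I" using I(3)[of "sym_diff J C \<inter> I"] by blast
    have "sym_diff C A \<inter> insert a I = J"
    proof -
      have "x \<in> sym_diff C A \<inter> insert a I \<longleftrightarrow> x \<in> J" for x
      proof -
        have "x \<in> A \<inter> I \<longleftrightarrow> x \<in> sym_diff J C \<inter> I" using A(2) by simp
        then show ?thesis using True J C(2) A(1) by (auto simp: \<V>_def)
      qed
      then show ?thesis by blast
    qed
    moreover have "sym_diff C A \<in> \<U>" using A(1) C(1) Suc.prems(1) by (simp add: \<V>_def)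
    ultimately show ?thesis by blast
  qed
  ultimately show ?case using I(1,2) by (intro exI[of _ "insert a I"]) auto
qed

section \<open>Affine representations modulo three\<close>

lemma three_cases:
  fixes x :: 3
  obtains "x = 0" | "x = 1" | "x = 2"
proof (cases x)
  case (of_int z)
  then have "z = 0 \<or> z = 1 \<or> z = 2" by auto
  then show ?thesis using of_int that by auto
qed

lemma three_times: "x + x + x = (0 :: 3)"
  by (cases x rule: three_cases) simp_all

lemma one_neq_minus_one: "(1 :: 3) \<noteq> -1"
  by simp

text \<open>The maps \<open>z \<mapsto> a z + b\<close> with \<open>a = \<plusminus>1\<close> on the field with three elements. They form the symmetric group
  of degree three, as a semidirect product of translations and signs; this makes the translation parts
  of two representations with equal signs subtractable.\<close>

definition affine3 :: "(3 \<times> 3) monoid" where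
  "affine3 = \<lparr>carrier = {1, -1} \<times> UNIV,
     monoid.mult = (\<lambda>(a, b) (c, d). (a * c, b + a * d)),
     one = (1, 0)\<rparr>"

lemma carrier_affine3: "p \<in> carrier affine3 \<longleftrightarrow> fst p = 1 \<or> fst p = -1"
  by (cases p) (simp add: affine3_def)

lemma mult_affine3 [simp]: "p \<otimes>\<^bsub>affine3\<^esub> q = (fst p * fst q, snd p + fst p * snd q)"
  by (simp add: affine3_def split_beta)

lemma one_affine3 [simp]: "\<one>\<^bsub>affine3\<^esub> = (1, 0)"
  by (simp add: affine3_def)

lemma group_affine3: "group affine3"
proof (rule groupI)
  fix p assume "p \<in> carrier affine3"
  then show "\<exists>q\<in>carrier affine3. q \<otimes>\<^bsub>affine3\<^esub> p = \<one>\<^bsub>affine3\<^esub>"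
    by (intro bexI[of _ "(fst p, - fst p * snd p)"]) (auto simp: carrier_affine3)
qed (auto simp: carrier_affine3 algebra_simps)

interpretation affine3: group affine3
  by (rule group_affine3)

lemma inv_affine3:
  "p \<in> carrier affine3 \<Longrightarrow> inv\<^bsub>affine3\<^esub> p = (fst p, - fst p * snd p)"
  by (rule affine3.inv_equality) (auto simp: carrier_affine3)

lemma translations_normal: "{p \<in> carrier affine3. fst p = 1} \<lhd> affine3"
  unfolding affine3.normal_inv_iff
proof (intro conjI ballI)
  show "subgroup {p \<in> carrier affine3. fst p = 1} affine3"
    by (rule affine3.subgroupI) (auto simp: carrier_affine3 inv_affine3)
qed (auto simp: carrier_affine3 inv_affine3)

lemma finite_supersoluble_affine3: "finite_supersoluble affine3"
proof -
  let ?T = "{p \<in> carrier affine3. fst p = 1}"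
  have pow: "p [^]\<^bsub>affine3\<^esub> (int k) = p [^]\<^bsub>affine3\<^esub> k" for p k by (rule int_pow_int)
  have "cyclic_over affine3 ?T (carrier affine3)"
    unfolding cyclic_over_def
  proof (intro bexI[of _ "(-1, 0)"] ballI)
    fix c assume c: "c \<in> carrier affine3"
    then have "\<exists>k::nat. c \<otimes>\<^bsub>affine3\<^esub> inv\<^bsub>affine3\<^esub> ((-1, 0) [^]\<^bsub>affine3\<^esub> k) \<in> ?T"
      by (intro exI[of _ "if fst c = 1 then 0 else 1"]) (auto simp: carrier_affine3 inv_affine3)
    then obtain k :: nat where
      "c \<otimes>\<^bsub>affine3\<^esub> inv\<^bsub>affine3\<^esub> ((-1, 0) [^]\<^bsub>affine3\<^esub> k) \<in> ?T" ..
    then show "\<exists>k::int. c \<otimes>\<^bsub>affine3\<^esub> inv\<^bsub>affine3\<^esub> ((-1, 0) [^]\<^bsub>affine3\<^esub> k) \<in> ?T"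
      by (intro exI[of _ "int k"]) (simp only: pow)
  qed (simp add: carrier_affine3)
  moreover have "cyclic_over affine3 {\<one>\<^bsub>affine3\<^esub>} ?T"
    unfolding cyclic_over_def
  proof (intro bexI[of _ "(1, 1)"] ballI)
    fix c assume c: "c \<in> ?T"
    have "\<exists>k::nat. c \<otimes>\<^bsub>affine3\<^esub> inv\<^bsub>affine3\<^esub> ((1, 1) [^]\<^bsub>affine3\<^esub> k) \<in> {\<one>\<^bsub>affine3\<^esub>}"
      by (cases "snd c" rule: three_cases)
         (use c in \<open>auto simp: carrier_affine3 inv_affine3 numeral_2_eq_2
            intro: exI[of _ 0] exI[of _ "Suc 0"] exI[of _ "Suc (Suc 0)"]\<close>)
    then obtain k :: nat where
      "c \<otimes>\<^bsub>affine3\<^esub> inv\<^bsub>affine3\<^esub> ((1, 1) [^]\<^bsub>affine3\<^esub> k) \<in> {\<one>\<^bsub>affine3\<^esub>}" ..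
    then show "\<exists>k::int. c \<otimes>\<^bsub>affine3\<^esub> inv\<^bsub>affine3\<^esub> ((1, 1) [^]\<^bsub>affine3\<^esub> k) \<in> {\<one>\<^bsub>affine3\<^esub>}"
      by (intro exI[of _ "int k"]) (simp only: pow)
  qed (simp add: carrier_affine3)
  ultimately have "supersoluble_above affine3 {\<one>\<^bsub>affine3\<^esub>}"
    using translations_normal affine3.one_is_normal affine3.normal_self supersoluble_above.top[of affine3]
    by (intro supersoluble_above.step[of "{\<one>\<^bsub>affine3\<^esub>}" affine3 ?T]
        supersoluble_above.step[of ?T affine3 "carrier affine3"]) (auto simp: carrier_affine3)
  moreover have "finite (carrier affine3)" by (simp add: affine3_def)
  ultimately show ?thesis by (simp add: finite_supersoluble_iff group_affine3)
qed

lemma (in group) hom_eq_on_generate: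
  assumes "group H" "f \<in> hom G H" "g \<in> hom G H" "A \<subseteq> carrier G" "\<And>a. a \<in> A \<Longrightarrow> f a = g a"
    "x \<in> generate G A"
  shows "f x = g x"
proof -
  interpret H: group H by fact
  interpret f: group_hom G H f using assms(2) by unfold_locales
  interpret g: group_hom G H g using assms(3) by unfold_locales
  show ?thesis
    using assms(6)
  proof (induction rule: generate.induct)
    case (inv a)
    then show ?case using assms(4,5) by auto
  next
    case (eng a b)
    then have "a \<in> carrier G" "b \<in> carrier G" using generate_in_carrier[OF assms(4)] by auto
    then show ?case using eng by simp
  qed (use assms(5) in auto)
qed

context
  fixes G :: "('a, 'b) monoid_scheme" (structure)
begin

lemma hom_affine3_linear_part:
  "h \<in> hom G affine3 \<Longrightarrow> (\<lambda>w. (fst (h w), 0)) \<in> hom G affine3"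
  by (auto simp: hom_def Pi_iff carrier_affine3)

lemma hom_affine3_linear_part_mult:
  "h \<in> hom G affine3 \<Longrightarrow> h' \<in> hom G affine3 \<Longrightarrow>
   (\<lambda>w. (fst (h w) * fst (h' w), 0)) \<in> hom G affine3"
  by (rule homI) (use hom_in_carrier[of h G affine3] hom_in_carrier[of h' G affine3] in
      \<open>fastforce simp: carrier_affine3, simp add: hom_mult\<close>)

lemma hom_affine3_diff:
  "h \<in> hom G affine3 \<Longrightarrow> h' \<in> hom G affine3 \<Longrightarrow> (\<And>w. w \<in> carrier G \<Longrightarrow> fst (h w) = fst (h' w)) \<Longrightarrow>
   (\<lambda>w. (fst (h w), snd (h w) - snd (h' w))) \<in> hom G affine3"
  by (auto simp: hom_def Pi_iff carrier_affine3 algebra_simps)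

end

text \<open>All homomorphisms from the free group to the affine group: \<open>T\<close> is the set of generators with
  sign \<open>-1\<close>, and \<open>b\<close> gives their translation parts.\<close>

locale affine3_representations =
  fixes d :: nat and \<theta> :: "nat set \<Rightarrow> (nat \<Rightarrow> 3) \<Rightarrow> (bool \<times> nat) list \<Rightarrow> 3 \<times> 3"
  assumes \<theta>_hom: "\<theta> T b \<in> hom (free_group {..<d}) affine3"
    and \<theta>_generator: "i < d \<Longrightarrow> \<theta> T b [(True, i)] = (if i \<in> T then -1 else 1, b i)"
begin

abbreviation F where "F \<equiv> free_group {..<d}"

sublocale F: group F
  by (rule group_free_group)

sublocale \<theta>: group_hom F affine3 "\<theta> T b" for T b
  using \<theta>_hom by unfold_locales

lemma generator_closed: "i < d \<Longrightarrow> [(True, i)] \<in> carrier F"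
  by (simp add: carrier_free_group)

lemma hom_F_eq:
  assumes "f \<in> hom F affine3" "g \<in> hom F affine3" "\<And>i. i < d \<Longrightarrow> f [(True, i)] = g [(True, i)]"
    "w \<in> carrier F"
  shows "f w = g w"
proof (rule F.hom_eq_on_generate[OF group_affine3 assms(1,2)])
  show "w \<in> generate F ((\<lambda>x. [(True, x)]) ` {..<d})"
    using assms(4) by (simp add: free_group_generated)
qed (use generator_closed assms(3) in auto)

lemma \<theta>_sign: "w \<in> carrier F \<Longrightarrow> fst (\<theta> T b w) = 1 \<or> fst (\<theta> T b w) = -1"
  using \<theta>.hom_closed[of w T b] by (simp add: carrier_affine3)

lemma sign_eq:
  assumes "w \<in> carrier F"
  shows "fst (\<theta> T b w) = fst (\<theta> T b' w)"
proof -
  have "(\<lambda>w. (fst (\<theta> T b w), 0 :: 3)) w = (\<lambda>w. (fst (\<theta> T b' w), 0)) w"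
    by (rule hom_F_eq[OF hom_affine3_linear_part[OF \<theta>_hom] hom_affine3_linear_part[OF \<theta>_hom] _ assms])
       (simp add: \<theta>_generator)
  then show ?thesis by simp
qed

lemma sign_sym_diff:
  assumes "w \<in> carrier F"
  shows "fst (\<theta> (sym_diff T T') b w) = fst (\<theta> T b w) * fst (\<theta> T' b w)"
proof -
  have "(\<lambda>w. (fst (\<theta> (sym_diff T T') b w), 0 :: 3)) w = (\<lambda>w. (fst (\<theta> T b w) * fst (\<theta> T' b w), 0)) w"
    by (rule hom_F_eq[OF hom_affine3_linear_part[OF \<theta>_hom]
          hom_affine3_linear_part_mult[OF \<theta>_hom \<theta>_hom] _ assms])
       (simp add: \<theta>_generator)
  then show ?thesis by simp
qed

lemma translation_diff:
  assumes "w \<in> carrier F" "\<And>i. i < d \<Longrightarrow> c i = b i - b' i"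
  shows "snd (\<theta> T c w) = snd (\<theta> T b w) - snd (\<theta> T b' w)"
proof -
  have "\<theta> T c w = (\<lambda>w. (fst (\<theta> T b w), snd (\<theta> T b w) - snd (\<theta> T b' w))) w"
    by (rule hom_F_eq[OF \<theta>_hom hom_affine3_diff[OF \<theta>_hom \<theta>_hom sign_eq] _ assms(1)])
       (auto simp: \<theta>_generator assms(2))
  then show ?thesis by simp
qed

lemma representation_kernel: "kernel F affine3 (\<theta> T b) \<in> quotient_kernels finite_supersoluble F"
  by (rule \<theta>.kernel_in_quotient_kernels[OF finite_supersoluble_affine3])

text \<open>Translation parts outside the generators have no influence on the kernel; fixing them makes the
  finiteness of the set immediate.\<close>

definition representation_kernels where
  "representation_kernels = (\<lambda>(T, b). kernel F affine3 (\<theta> T b)) ` (Pow {..<d} \<times> ({..<d} \<rightarrow>\<^sub>E UNIV))"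

lemma finite_representation_kernels: "finite representation_kernels"
  unfolding representation_kernels_def by (intro finite_imageI finite_cartesian_product finite_PiE) auto

abbreviation "P \<equiv> pro_completion finite_supersoluble F"

text \<open>One word represents an element of the completion in all the affine representations at once, so that
  its signs and translation parts can be computed in the free group.\<close>

lemma representative:
  assumes "s \<in> carrier P"
  obtains w where "w \<in> carrier F"
    "\<And>T b. T \<subseteq> {..<d} \<Longrightarrow> b \<in> {..<d} \<rightarrow>\<^sub>E UNIV \<Longrightarrow>
       s (kernel F affine3 (\<theta> T b)) = kernel F affine3 (\<theta> T b) #>\<^bsub>F\<^esub> w"
proof -
  have "representation_kernels \<subseteq> quotient_kernels finite_supersoluble F"
    unfolding representation_kernels_def using representation_kernel by auto
  then obtain N where N: "N \<in> quotient_kernels finite_supersoluble F" "\<And>M. M \<in> representation_kernels \<Longrightarrow> N \<subseteq> M"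
    using F.quotient_kernels_Inter[OF finite_representation_kernels] by blast
  obtain w where w: "w \<in> carrier F" "s N = N #>\<^bsub>F\<^esub> w"
    using F.pro_completion_coset[OF assms N(1)] by blast
  have "s (kernel F affine3 (\<theta> T b)) = kernel F affine3 (\<theta> T b) #>\<^bsub>F\<^esub> w"
    if "T \<subseteq> {..<d}" "b \<in> {..<d} \<rightarrow>\<^sub>E UNIV" for T b
  proof -
    have "kernel F affine3 (\<theta> T b) \<in> representation_kernels" using that unfolding representation_kernels_def by force
    then show ?thesis
      using F.pro_completion_coarser[OF assms N(1) representation_kernel _ w] N(2) by blast
  qed
  then show thesis using that w(1) by blast
qed

lemma not_invariably_generates_if_subgroup:
  assumes K: "subgroup K affine3"
    and Tb: "T \<subseteq> {..<d}" "b \<in> {..<d} \<rightarrow>\<^sub>E UNIV"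
    and proper: "i < d" "\<theta> T b [(True, i)] \<notin> K"
    and w: "\<And>s. s \<in> S \<Longrightarrow> w s \<in> carrier F"
      "\<And>s. s \<in> S \<Longrightarrow> s (kernel F affine3 (\<theta> T b)) = kernel F affine3 (\<theta> T b) #>\<^bsub>F\<^esub> w s"
    and conj: "\<And>s. s \<in> S \<Longrightarrow>
      \<exists>g\<in>carrier F. \<theta> T b (inv\<^bsub>F\<^esub> g \<otimes>\<^bsub>F\<^esub> w s \<otimes>\<^bsub>F\<^esub> g) \<in> K"
  shows "\<not> invariably_generates P (pro_topology finite_supersoluble F) S"
proof (rule F.not_invariably_generates_if_conjugate_into[OF representation_kernel \<theta>.subgroup_vimage[OF K]])
  show "kernel F affine3 (\<theta> T b) \<subseteq> {x \<in> carrier F. \<theta> T b x \<in> K}"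
    using subgroup.one_closed[OF K] by (auto simp: kernel_def)
  show "{x \<in> carrier F. \<theta> T b x \<in> K} \<noteq> carrier F"
    using generator_closed[OF proper(1)] proper(2) by blast
  fix s assume s: "s \<in> S"
  obtain g where g: "g \<in> carrier F" "\<theta> T b (inv\<^bsub>F\<^esub> g \<otimes>\<^bsub>F\<^esub> w s \<otimes>\<^bsub>F\<^esub> g) \<in> K"
    using conj[OF s] by blast
  have "inv\<^bsub>F\<^esub> g \<otimes>\<^bsub>F\<^esub> w s \<otimes>\<^bsub>F\<^esub> g \<in> {x \<in> carrier F. \<theta> T b x \<in> K}"
    using g w(1)[OF s] by simp
  then show "\<exists>w\<in>carrier F. \<exists>g\<in>carrier F. s (kernel F affine3 (\<theta> T b)) = kernel F affine3 (\<theta> T b) #>\<^bsub>F\<^esub> w \<and>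
      inv\<^bsub>F\<^esub> g \<otimes>\<^bsub>F\<^esub> w \<otimes>\<^bsub>F\<^esub> g \<in> {x \<in> carrier F. \<theta> T b x \<in> K}"
    using w[OF s] g(1) by blast
qed

text \<open>An affine map \<open>z \<mapsto> -z + c\<close> has the fixed point \<open>-c\<close>. As the powers of \<open>u\<close> induce all translations,
  conjugating by one of them moves this fixed point to \<open>0\<close>.\<close>

lemma sign_flip_conjugate:
  assumes u: "u \<in> carrier F" "fst (\<theta> T b u) = 1" "snd (\<theta> T b u) \<noteq> 0"
    and w: "w \<in> carrier F" "fst (\<theta> T b w) = -1"
  shows "\<exists>g\<in>carrier F. snd (\<theta> T b (inv\<^bsub>F\<^esub> g \<otimes>\<^bsub>F\<^esub> w \<otimes>\<^bsub>F\<^esub> g)) = 0"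
proof -
  define t where "t = snd (\<theta> T b u)"
  have \<theta>u: "\<theta> T b u = (1, t)" using u(2) by (simp add: t_def prod_eq_iff)
  have "\<exists>g\<in>carrier F. \<theta> T b g = (1, p)" for p
  proof -
    have "p = 0 \<or> p = t \<or> p = t + t"
      using u(3) unfolding t_def[symmetric]
      by (cases p rule: three_cases; cases t rule: three_cases) simp_all
    moreover have "\<theta> T b \<one>\<^bsub>F\<^esub> = (1, 0)" using \<theta>.hom_one[of T b] by simp
    moreover have "\<theta> T b (u \<otimes>\<^bsub>F\<^esub> u) = (1, t + t)" using u(1) \<theta>u by simp
    ultimately show ?thesis using \<theta>u u(1) F.one_closed F.m_closed by metis
  qed
  then obtain g where g: "g \<in> carrier F" "\<theta> T b g = (1, - snd (\<theta> T b w))" by blast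
  have "\<theta> T b (inv\<^bsub>F\<^esub> g) = (1, snd (\<theta> T b w))"
    using g \<theta>.hom_inv[OF g(1), of T b] by (simp add: inv_affine3 carrier_affine3)
  then have "snd (\<theta> T b (inv\<^bsub>F\<^esub> g \<otimes>\<^bsub>F\<^esub> w \<otimes>\<^bsub>F\<^esub> g)) =
      snd (\<theta> T b w) + snd (\<theta> T b w) + snd (\<theta> T b w)"
    using g w by simp
  then show ?thesis using g(1) three_times by metis
qed

text \<open>If two sign vectors agree on \<open>S\<close>, their product is a nontrivial sign that is trivial on \<open>S\<close>. Otherwise
  the \<open>2\<^sup>d\<close> sign vectors restricted to \<open>S\<close> shatter \<open>d\<close> elements, and some sign is \<open>-1\<close> on all of these.
  It is \<open>+1\<close> on a set \<open>R\<close> of at most \<open>d - 2\<close> elements, so there are fewer conditions than the \<open>d - 1\<close> free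
  translation parts that remain when a generator with sign \<open>-1\<close> is made to fix \<open>0\<close>. Hence some
  nonzero choice of translation parts is trivial on \<open>R\<close>. Then every element of \<open>S\<close> has a conjugate that
  fixes \<open>0\<close>, but not all generators fix \<open>0\<close>.\<close>

theorem invariable_generation_lower_bound:
  assumes d: "d \<ge> 1" and S: "finite S" "card S < 2 * d - 1"
  shows "\<not> invariably_generates P (pro_topology finite_supersoluble F) S"
proof
  assume gen: "invariably_generates P (pro_topology finite_supersoluble F) S"
  then have "S \<subseteq> carrier P" by (simp add: invariably_generates_def)
  then have "\<exists>w. w \<in> carrier F \<and> (\<forall>T b. T \<subseteq> {..<d} \<longrightarrow> b \<in> {..<d} \<rightarrow>\<^sub>E UNIV \<longrightarrow>
       s (kernel F affine3 (\<theta> T b)) = kernel F affine3 (\<theta> T b) #>\<^bsub>F\<^esub> w)" if "s \<in> S" for s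
  proof -
    have "s \<in> carrier P" using \<open>S \<subseteq> carrier P\<close> that by blast
    then show ?thesis by (rule representative) blast
  qed
  then have "\<forall>s\<in>S. \<exists>w. w \<in> carrier F \<and> (\<forall>T b. T \<subseteq> {..<d} \<longrightarrow> b \<in> {..<d} \<rightarrow>\<^sub>E UNIV \<longrightarrow>
       s (kernel F affine3 (\<theta> T b)) = kernel F affine3 (\<theta> T b) #>\<^bsub>F\<^esub> w)" by blast
  from bchoice[OF this] obtain w where W: "\<forall>s\<in>S. w s \<in> carrier F \<and>
       (\<forall>T b. T \<subseteq> {..<d} \<longrightarrow> b \<in> {..<d} \<rightarrow>\<^sub>E UNIV \<longrightarrow>
         s (kernel F affine3 (\<theta> T b)) = kernel F affine3 (\<theta> T b) #>\<^bsub>F\<^esub> w s)" ..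
  have w: "\<And>s. s \<in> S \<Longrightarrow> w s \<in> carrier F"
    "\<And>s T b. s \<in> S \<Longrightarrow> T \<subseteq> {..<d} \<Longrightarrow> b \<in> {..<d} \<rightarrow>\<^sub>E UNIV \<Longrightarrow>
       s (kernel F affine3 (\<theta> T b)) = kernel F affine3 (\<theta> T b) #>\<^bsub>F\<^esub> w s"
    using W by (blast, blast)
  define \<chi> where "\<chi> T s = fst (\<theta> T (\<lambda>_. 0) (w s))" for T s
  have \<chi>: "fst (\<theta> T b (w s)) = \<chi> T s" if "s \<in> S" for T b s
    unfolding \<chi>_def by (rule sign_eq[OF w(1)[OF that]])
  have \<chi>_cases: "\<chi> T s = 1 \<or> \<chi> T s = -1" if "s \<in> S" for T s
    unfolding \<chi>_def by (rule \<theta>_sign[OF w(1)[OF that]])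
  have \<chi>_sym_diff: "\<chi> (sym_diff T T') s = \<chi> T s * \<chi> T' s" if "s \<in> S" for T T' s
    unfolding \<chi>_def by (rule sign_sym_diff[OF w(1)[OF that]])
  define U where "U T = {s \<in> S. \<chi> T s = -1}" for T
  have U_sym_diff: "U (sym_diff T T') = sym_diff (U T) (U T')" for T T'
  proof -
    have "s \<in> U (sym_diff T T') \<longleftrightarrow> s \<in> sym_diff (U T) (U T')" for s
    proof (cases "s \<in> S")
      case True
      show ?thesis
        using True \<chi>_cases[OF True, of T] \<chi>_cases[OF True, of T'] one_neq_minus_one
        by (auto simp: U_def \<chi>_sym_diff[OF True])
    qed (auto simp: U_def)
    then show ?thesis by blast
  qed
  show False
  proof (cases "inj_on U (Pow {..<d})")
    case False
    then obtain T T' where T: "T \<subseteq> {..<d}" "T' \<subseteq> {..<d}" "T \<noteq> T'" "U T = U T'"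
      by (auto simp: inj_on_def)
    then obtain i where i: "i \<in> sym_diff T T'" by blast
    let ?b = "restrict (\<lambda>_. 0) {..<d} :: nat \<Rightarrow> 3"
    have "U (sym_diff T T') = {}" using T(4) U_sym_diff[of T T'] by simp
    then have one: "\<chi> (sym_diff T T') s = 1" if "s \<in> S" for s
      using \<chi>_cases[OF that] that by (auto simp: U_def)
    have "\<not> invariably_generates P (pro_topology finite_supersoluble F) S"
    proof (rule not_invariably_generates_if_subgroup
        [OF normal_imp_subgroup[OF translations_normal], of "sym_diff T T'" ?b i S w])
      show "sym_diff T T' \<subseteq> {..<d}" "i < d" using T i by auto
      then show "\<theta> (sym_diff T T') ?b [(True, i)] \<notin> {p \<in> carrier affine3. fst p = 1}"
        using i by (auto simp: \<theta>_generator)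
    next
      fix s assume s: "s \<in> S"
      have "\<theta> (sym_diff T T') ?b (w s) \<in> {p \<in> carrier affine3. fst p = 1}"
        using one[OF s] \<chi>[OF s] w(1)[OF s] by (simp add: carrier_affine3)
      then show "\<exists>g\<in>carrier F. \<theta> (sym_diff T T') ?b (inv\<^bsub>F\<^esub> g \<otimes>\<^bsub>F\<^esub> w s \<otimes>\<^bsub>F\<^esub> g)
          \<in> {p \<in> carrier affine3. fst p = 1}"
        using w(1)[OF s] by (intro bexI[of _ "\<one>\<^bsub>F\<^esub>"]) simp_all
      show "s (kernel F affine3 (\<theta> (sym_diff T T') ?b)) = kernel F affine3 (\<theta> (sym_diff T T') ?b) #>\<^bsub>F\<^esub> w s"
        by (rule w(2)[OF s]) (use T in auto)
    qed (use w(1) in auto)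
    then show False using gen by simp
  next
    case True
    have card_U: "2 ^ d \<le> card (U ` Pow {..<d})" using card_image[OF True] by (simp add: card_Pow)
    have closed: "sym_diff A B \<in> U ` Pow {..<d}" if AB: "A \<in> U ` Pow {..<d}" "B \<in> U ` Pow {..<d}" for A B
    proof -
      obtain T T' where "A = U T" "B = U T'" "T \<subseteq> {..<d}" "T' \<subseteq> {..<d}" using AB by blast
      then show ?thesis using U_sym_diff[of T T'] by (intro image_eqI[of _ _ "sym_diff T T'"]) auto
    qed
    have "\<exists>I. finite I \<and> card I = d \<and> (\<forall>J\<subseteq>I. \<exists>A\<in>U ` Pow {..<d}. A \<inter> I = J)"
      by (rule shattered_set[OF closed card_U])
    then obtain I where I: "finite I" "card I = d" "\<forall>J\<subseteq>I. \<exists>A\<in>U ` Pow {..<d}. A \<inter> I = J"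
      by (elim exE conjE)
    then have "\<exists>A\<in>U ` Pow {..<d}. A \<inter> I = I" by blast
    then obtain T where T: "T \<subseteq> {..<d}" "I \<subseteq> U T" by blast
    define R where "R = S - U T"
    have US: "U T \<subseteq> S" by (auto simp: U_def)
    have "d \<le> card (U T)" using card_mono[OF finite_subset[OF US S(1)] T(2)] I(2) by simp
    then have card_R: "card R < d - 1"
      using S(2) card_Diff_subset[OF finite_subset[OF US S(1)] US] card_mono[OF S(1) US]
      unfolding R_def by linarith
    have "I \<noteq> {}" using I(2) d by auto
    moreover have "U {} = {}" using U_sym_diff[of "{}" "{}"] by simp
    ultimately have "T \<noteq> {}" using T(2) by auto
    then obtain k where k: "k \<in> T" by blast
    let ?D = "({..<d} - {k}) \<rightarrow>\<^sub>E (UNIV :: 3 set)"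
    define e where "e b = restrict (\<lambda>i. if i = k then 0 else b i) {..<d}" for b :: "nat \<Rightarrow> 3"
    define \<Phi> where "\<Phi> b = restrict (\<lambda>s. snd (\<theta> T (e b) (w s))) R" for b
    have "card (R \<rightarrow>\<^sub>E (UNIV :: 3 set)) = 3 ^ card R"
      using S(1) by (subst card_PiE) (auto simp: R_def)
    moreover have "card ?D = 3 ^ (d - 1)"
      using k T(1) by (subst card_PiE) auto
    moreover have "(3::nat) ^ card R < 3 ^ (d - 1)" using card_R by simp
    moreover have "card (\<Phi> ` ?D) \<le> card (R \<rightarrow>\<^sub>E (UNIV :: 3 set))"
      using S(1) by (intro card_mono finite_PiE) (auto simp: R_def \<Phi>_def)
    ultimately have "\<not> inj_on \<Phi> ?D" using card_image[of \<Phi> ?D] by linarith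
    then obtain b b' where b: "b \<in> ?D" "b' \<in> ?D" "b \<noteq> b'" "\<Phi> b = \<Phi> b'"
      by (auto simp: inj_on_def)
    then obtain i where i: "i \<in> {..<d} - {k}" "b i \<noteq> b' i" using PiE_ext[OF b(1,2)] by blast
    define c where "c = restrict (\<lambda>i. e b i - e b' i) {..<d}"
    have c: "c \<in> {..<d} \<rightarrow>\<^sub>E UNIV" by (simp add: c_def)
    have ck: "k < d" "c k = 0" using k T(1) by (auto simp: c_def e_def)
    have ci: "i < d" "c i \<noteq> 0" using i by (auto simp: c_def e_def)
    \<comment> \<open>A nontrivial translation in the image: a generator with sign \<open>-1\<close> has to be corrected by one that fixes \<open>0\<close>.\<close>
    define u where "u = (if i \<in> T then [(True, i)] \<otimes>\<^bsub>F\<^esub> [(True, k)] else [(True, i)])"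
    have u: "u \<in> carrier F" "fst (\<theta> T c u) = 1" "snd (\<theta> T c u) \<noteq> 0"
      using generator_closed[OF ci(1)] generator_closed[OF ck(1)] ci ck k
      by (auto simp: u_def \<theta>_generator)
    have sK: "subgroup {p \<in> carrier affine3. snd p = 0} affine3"
      by (rule affine3.subgroupI) (auto simp: carrier_affine3 inv_affine3)
    have "\<not> invariably_generates P (pro_topology finite_supersoluble F) S"
    proof (rule not_invariably_generates_if_subgroup[OF sK T(1) c ci(1), of S w])
      show "\<theta> T c [(True, i)] \<notin> {p \<in> carrier affine3. snd p = 0}"
        using ci by (simp add: \<theta>_generator)
    next
      fix s assume s: "s \<in> S"
      have "\<exists>g\<in>carrier F. snd (\<theta> T c (inv\<^bsub>F\<^esub> g \<otimes>\<^bsub>F\<^esub> w s \<otimes>\<^bsub>F\<^esub> g)) = 0"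
      proof (cases "s \<in> U T")
        case True
        then show ?thesis using sign_flip_conjugate[OF u w(1)[OF s]] \<chi>[OF s] by (simp add: U_def)
      next
        case False
        then have "\<Phi> b s = \<Phi> b' s" "s \<in> R" using b(4) s by (auto simp: R_def)
        then have "snd (\<theta> T c (w s)) = 0"
          using translation_diff[OF w(1)[OF s], of c "e b" "e b'" T] by (simp add: \<Phi>_def c_def)
        then show ?thesis using w(1)[OF s] by (intro bexI[of _ "\<one>\<^bsub>F\<^esub>"]) simp_all
      qed
      then obtain g where g: "g \<in> carrier F" "snd (\<theta> T c (inv\<^bsub>F\<^esub> g \<otimes>\<^bsub>F\<^esub> w s \<otimes>\<^bsub>F\<^esub> g)) = 0"
        by blast
      have "inv\<^bsub>F\<^esub> g \<otimes>\<^bsub>F\<^esub> w s \<otimes>\<^bsub>F\<^esub> g \<in> carrier F" using g(1) w(1)[OF s] by simp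
      from \<theta>.hom_closed[OF this, of T c] g(2)
      have "\<theta> T c (inv\<^bsub>F\<^esub> g \<otimes>\<^bsub>F\<^esub> w s \<otimes>\<^bsub>F\<^esub> g) \<in> {p \<in> carrier affine3. snd p = 0}" by blast
      then show "\<exists>g\<in>carrier F. \<theta> T c (inv\<^bsub>F\<^esub> g \<otimes>\<^bsub>F\<^esub> w s \<otimes>\<^bsub>F\<^esub> g) \<in> {p \<in> carrier affine3. snd p = 0}"
        using g(1) by (rule rev_bexI[rotated])
      show "s (kernel F affine3 (\<theta> T c)) = kernel F affine3 (\<theta> T c) #>\<^bsub>F\<^esub> w s"
        by (rule w(2)[OF s T(1) c])
    qed (use w(1) in auto)
    then show False using gen by simp
  qed
qed

end

lemma affine3_representations_exist: "\<exists>\<theta>. affine3_representations d \<theta>"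
proof -
  have "\<forall>T b. \<exists>h. h \<in> hom (free_group {..<d}) affine3 \<and>
      (\<forall>i\<in>{..<d}. h [(True, i)] = (if i \<in> T then -1 else 1, b i))"
  proof (intro allI)
    fix T :: "nat set" and b :: "nat \<Rightarrow> 3"
    have "(\<lambda>i. (if i \<in> T then -1 else 1, b i)) \<in> {..<d} \<rightarrow> carrier affine3"
      by (auto simp: carrier_affine3)
    from free_group_universal[OF group_affine3 this]
    show "\<exists>h. h \<in> hom (free_group {..<d}) affine3 \<and>
      (\<forall>i\<in>{..<d}. h [(True, i)] = (if i \<in> T then -1 else 1, b i))" by blast
  qed
  then obtain \<theta> where "\<forall>T b. \<theta> T b \<in> hom (free_group {..<d}) affine3 \<and>
      (\<forall>i\<in>{..<d}. \<theta> T b [(True, i)] = (if i \<in> T then -1 else 1, b i))"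
    by metis
  then show ?thesis by (intro exI[of _ \<theta>]) (simp add: affine3_representations_def)
qed

section \<open>The invariable rank\<close>

theorem theorem3:
  fixes d :: nat
  assumes "d \<ge> 1"
  shows "d_I (free_prosupersoluble d) (free_prosupersoluble_topology d) = enat (2 * d - 1)"
proof -
  let ?G = "free_group {..<d}"
  let ?gens = "\<lambda>S. finite S \<and> invariably_generates (free_prosupersoluble d) (free_prosupersoluble_topology d) S"
  interpret G: group ?G by (rule group_free_group)
  obtain \<theta> where "affine3_representations d \<theta>" using affine3_representations_exist by blast
  then interpret affine3_representations d \<theta> .
  have lower: "2 * d - 1 \<le> card S" if "?gens S" for S
    using invariable_generation_lower_bound[OF assms, of S] that
    by (auto simp: free_prosupersoluble_def free_prosupersoluble_topology_def not_less[symmetric])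
  define xs where "xs = map (\<lambda>i. [(True, i)]) [0..<d]"
  define A where "A = (\<lambda>x. pro_element finite_supersoluble ?G (\<lambda>_. x)) ` set xs"
  define B where "B = (\<lambda>i. G.pro_witness (take i xs) (xs ! i)) ` {1..<length xs}"
  have "set xs = (\<lambda>i. [(True, i)]) ` {..<d}" by (auto simp: xs_def)
  then have xs: "set xs \<subseteq> carrier ?G" "generate ?G (set xs) = carrier ?G"
    using free_group_generated[of "{..<d}"] by (auto simp: carrier_free_group)
  have "?gens (A \<union> B)"
    using G.generators_and_pro_witnesses_invariably_generate[OF xs]
    by (simp add: A_def B_def free_prosupersoluble_def free_prosupersoluble_topology_def)
  moreover have "card A \<le> d" "card B \<le> d - 1"
    using card_image_le[of "set xs" "\<lambda>x. pro_element finite_supersoluble ?G (\<lambda>_. x)"] card_length[of xs]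
      card_image_le[of "{1..<length xs}" "\<lambda>i. G.pro_witness (take i xs) (xs ! i)"]
    by (simp_all add: A_def B_def xs_def)
  then have "card (A \<union> B) \<le> 2 * d - 1" using card_Un_le[of A B] by linarith
  ultimately have "d_I (free_prosupersoluble d) (free_prosupersoluble_topology d) \<le> enat (2 * d - 1)"
    unfolding d_I_def by (intro Inf_lower2[of "enat (card (A \<union> B))"]) auto
  moreover have "enat (2 * d - 1) \<le> d_I (free_prosupersoluble d) (free_prosupersoluble_topology d)"
    unfolding d_I_def using lower by (intro Inf_greatest) auto
  ultimately show ?thesis by (rule antisym)
qed

end
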